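(* Let $f\in W^3_\infty(\mathbb{R})$ and $\tau>0$. There is a constant $c_{f,\tau}>0$, depending on $f$ and $\tau$ but independent of $k_0$, such that the following holds. Let $k_0\in\mathbb{Z}_+$, let $\{S_k\}$ be the NUCC scheme acting on the initial data $\mathbf{f}^0=\{f(2^{-k_0}(n-\tfrac12)):n\in\mathbb{Z}\}$, and let $\mathbf{f}^\infty=\lim_{k\to\infty}S_k\cdots S_0\mathbf{f}^0$ be the limit function. Let $\overline{t}=2^{-k_0}t^{k+1}_j$ (with $k\in\mathbb{Z}_+$, $j\in\mathbb{Z}$) be a dyadic point. If $|f(t)|\ge\tau$ for all $t$ with $|t-\overline{t}|\le 2^{-k_0-k}$, then $$|\mathbf{f}^\infty(\overline{t})-f(\overline{t})|\le c_{f,\tau}\,2^{-3k_0}.$$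
   Context: Notation. $\mathbb{Z}_+$ is the set of nonnegative integers; $t^k_j:=2^{-k}(j-\tfrac12)$; $W^3_\infty(\mathbb{R})$ is the space of $f:\mathbb{R}\to\mathbb{R}$ with $\sum_{n=0}^3\|f^{(n)}\|_\infty<\infty$. A linear non-uniform subdivision operator $S_k$ with masks $\mathbf{a}^{j,k}=\{\mathbf{a}^{j,k}_n:n\in\mathbb{Z}\}$ acts on real sequences $\mathbf{g}$ by $(S_k\mathbf{g})_{2j+\nu}=\sum_{i\in\mathbb{Z}}\mathbf{a}^{j,k}_{2i+\nu}\mathbf{g}_{j-i}$, $\nu=0,1$. $S_{\mathbf a}$ is the classical corner-cutting operator, with mask $\mathbf{a}_{-2}=\tfrac14,\ \mathbf{a}_{-1}=\mathbf{a}_0=\tfrac34,\ \mathbf{a}_1=\tfrac14$ (other entries zero) for all $j,k$. The NUCC scheme acting on $\mathbf{f}^0$. Put $\mathbf{d}^0_j:=\mathbf{f}^0_{j-1}-2\mathbf{f}^0_j+\mathbf{f}^0_{j+1}$ and $\mathbf{d}^k:=S_{\mathbf a}^k\mathbf{d}^0$. The operators $S_k$ and data $\mathbf{f}^{k+1}:=S_k\mathbf{f}^k$ are built recursively: for $j\in\mathbb{Z}$, $\nu\in\{0,1\}$, let $$\gamma_{2j+\nu}=\gamma_{2j+\nu,k}:=\sqrt{\frac{\mathbf{d}^k_{j+\nu}}{\mathbf{f}^k_{j+\nu}+\epsilon}}$$ (real or purely imaginary), where $|\epsilon|=2^{-2k_0}$ and the sign of $\epsilon$ is that of $\mathbf{f}^k_{j+\nu}$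 (either sign if $\mathbf{f}^k_{j+\nu}=0$). The only nonzero mask entries are $$\mathbf{a}^{j,k}_{-2}=\frac{\sinh(\frac14\gamma_{2j}2^{-k})}{\sinh(\gamma_{2j}2^{-k})},\quad \mathbf{a}^{j,k}_{-1}=\frac{\sinh(\frac34\gamma_{2j+1}2^{-k})}{\sinh(\gamma_{2j+1}2^{-k})},\quad \mathbf{a}^{j,k}_{0}=\frac{\sinh(\frac34\gamma_{2j}2^{-k})}{\sinh(\gamma_{2j}2^{-k})},\quad \mathbf{a}^{j,k}_{1}=\frac{\sinh(\frac14\gamma_{2j+1}2^{-k})}{\sinh(\gamma_{2j+1}2^{-k})},$$ with the limits $\tfrac14,\tfrac34$ when $\gamma=0$. Standing assumptions. The shape parameters are uniformly bounded, and $\mathbf{a}_n-\tfrac14<\mathbf{a}^{j,k}_n<\mathbf{a}_n+\tfrac14$ for all $j,k$ and $n\in\{-2,-1,0,1\}$. Limit function. The value $\mathbf{f}^k_j$ is attached to the point $2^{-k_0}t^k_j$; $\mathbf{f}^\infty\in C(\mathbb{R})$ is the function with $\lim_{k\to\infty}\sup_{j\in\mathbb{Z}\cap2^k\Omega}|\mathbf{f}^k_j-\mathbf{f}^\infty(2^{-k_0}t^k_j)|=0$ for every compact $\Omega\subset\mathbb{R}$. *)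

theory Defs
  imports "HOL-Analysis.Analysis" "HOL-Probability.Essential_Supremum"
begin

text \<open>
  The Sobolev space of order \<open>r\<close> with exponent infinity on the real line, with continuous
  representatives. \<open>D n\<close> is the \<open>n\<close>-th derivative: that \<open>D n\<close> is an indefinite Lebesgue integral of
  \<open>D (Suc n)\<close> says that \<open>D n\<close> is locally absolutely continuous with derivative \<open>D (Suc n)\<close> almost
  everywhere (everywhere if \<open>n + 1 < r\<close>).
\<close>

definition sobolev_inf :: "nat \<Rightarrow> (real \<Rightarrow> real) set" where
  "sobolev_inf r = {f. \<exists>D :: nat \<Rightarrow> real \<Rightarrow> real.
      D 0 = f \<and>
      (\<forall>n\<le>r. D n \<in> borel_measurable lborel) \<and>
      (\<forall>n<r. \<forall>a b. a \<le> b \<longrightarrow> D n b - D n a = (LINT x:{a..b}|lborel. D (Suc n) x)) \<and>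
      (\<Sum>n\<le>r. esssup lborel (\<lambda>x. ereal \<bar>D n x\<bar>)) < \<infinity>}"

definition grid :: "nat \<Rightarrow> int \<Rightarrow> real" where
  "grid k j = (real_of_int j - 1 / 2) / 2 ^ k"

text \<open>
  A mask \<open>a\<close> of one subdivision level is written \<open>a j n\<close>. An index \<open>l = 2 j + \<nu>\<close> with
  \<open>\<nu> \<in> {0, 1}\<close> has \<open>j = l div 2\<close> and \<open>\<nu> = l mod 2\<close>.
\<close>

definition subdiv :: "(int \<Rightarrow> int \<Rightarrow> real) \<Rightarrow> (int \<Rightarrow> real) \<Rightarrow> int \<Rightarrow> real" where
  "subdiv a g l = (\<Sum>\<^sub>\<infinity>i. a (l div 2) (2 * i + l mod 2) * g (l div 2 - i))"

definition cc_mask :: "int \<Rightarrow> real" where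
  "cc_mask n = (if n = -1 \<or> n = 0 then 3 / 4 else if n = -2 \<or> n = 1 then 1 / 4 else 0)"

definition second_diff :: "(int \<Rightarrow> real) \<Rightarrow> int \<Rightarrow> real" where
  "second_diff g j = g (j - 1) - 2 * g j + g (j + 1)"

definition cc_data :: "(int \<Rightarrow> real) \<Rightarrow> nat \<Rightarrow> int \<Rightarrow> real" where
  "cc_data d0 k = (subdiv (\<lambda>_. cc_mask) ^^ k) d0"

text \<open>
  The shape parameter \<open>\<gamma>\<^sub>l\<close> with \<open>l = 2 j + \<nu>\<close> is computed from the data at the index \<open>j + \<nu>\<close>.
  It is complex because the radicand may be negative; \<open>e l\<close> is the regularization
  \<open>\<epsilon>\<close> used for this parameter.
\<close>

definition data_index :: "int \<Rightarrow> int" where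
  "data_index l = l div 2 + l mod 2"

definition shape_param :: "(int \<Rightarrow> real) \<Rightarrow> (int \<Rightarrow> real) \<Rightarrow> (int \<Rightarrow> real) \<Rightarrow> int \<Rightarrow> complex" where
  "shape_param e d g l =
     csqrt (complex_of_real (d (data_index l) / (g (data_index l) + e l)))"

text \<open>
  For real or purely imaginary \<open>z\<close> the quotient is real, see \<open>sinh_ratio_real\<close>. At a zero
  \<open>z \<noteq> 0\<close> of \<open>sinh\<close> the value is the junk value 0 of a division by 0; the bound on
  the mask entries in \<open>nucc_standing\<close> excludes this case.
\<close>

definition sinh_ratio :: "real \<Rightarrow> complex \<Rightarrow> real" where
  "sinh_ratio c z = (if z = 0 then c else Re (sinh (of_real c * z) / sinh z))"

lemma sinh_of_real_complex: "sinh (complex_of_real w) = of_real (sinh w)"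
  by (simp add: sinh_field_def exp_of_real flip: of_real_minus)

lemma sinh_i_times: "sinh (\<i> * z) = \<i> * sin (z::complex)"
  by (simp add: sin_exp_eq sinh_field_def field_simps)

lemma sinh_ratio_real:
  assumes "z = csqrt (complex_of_real x) * of_real h" "z \<noteq> 0"
  shows "complex_of_real (sinh_ratio c z) = sinh (of_real c * z) / sinh z"
proof -
  have "sinh (of_real c * z) / sinh z \<in> \<real>"
  proof (cases "x \<ge> 0")
    case True
    define y where "y = sqrt x * h"
    have "z = of_real y" using True assms by (simp add: csqrt_of_real' y_def)
    then have "sinh (of_real c * z) / sinh z = of_real (sinh (c * y) / sinh y)"
      by (simp flip: sinh_of_real_complex)
    then show ?thesis by simp
  next
    case False
    define y where "y = sqrt (-x) * h"
    have "z = \<i> * of_real y" using False assms by (simp add: csqrt_of_real' y_def)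
    then have "sinh (of_real c * z) / sinh z = of_real (sin (c * y) / sin y)"
      using sinh_i_times[of "of_real (c*y)"] sinh_i_times[of "of_real y"]
      by (simp add: mult.left_commute flip: sin_of_real)
    then show ?thesis by simp
  qed
  then show ?thesis using assms by (simp add: sinh_ratio_def of_real_Re)
qed

definition nucc_mask ::
    "nat \<Rightarrow> (int \<Rightarrow> real) \<Rightarrow> (int \<Rightarrow> real) \<Rightarrow> (int \<Rightarrow> real) \<Rightarrow> int \<Rightarrow> int \<Rightarrow> real" where
  "nucc_mask k e d g j n =
     (let z = (\<lambda>l. shape_param e d g l / 2 ^ k) in
      if n = -2 then sinh_ratio (1 / 4) (z (2 * j))
      else if n = -1 then sinh_ratio (3 / 4) (z (2 * j + 1))
      else if n = 0 then sinh_ratio (3 / 4) (z (2 * j))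
      else if n = 1 then sinh_ratio (1 / 4) (z (2 * j + 1))
      else 0)"

text \<open>The data \<open>f\<^sup>k\<close> of the scheme for the initial data \<open>f0\<close> and the regularizations \<open>\<epsilon> k l\<close>.\<close>

primrec nucc :: "(nat \<Rightarrow> int \<Rightarrow> real) \<Rightarrow> (int \<Rightarrow> real) \<Rightarrow> nat \<Rightarrow> int \<Rightarrow> real" where
  "nucc \<epsilon> f0 0 = f0"
| "nucc \<epsilon> f0 (Suc k) =
     subdiv (nucc_mask k (\<epsilon> k) (cc_data (second_diff f0) k) (nucc \<epsilon> f0 k)) (nucc \<epsilon> f0 k)"

definition nucc_shape :: "(nat \<Rightarrow> int \<Rightarrow> real) \<Rightarrow> (int \<Rightarrow> real) \<Rightarrow> nat \<Rightarrow> int \<Rightarrow> complex" where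
  "nucc_shape \<epsilon> f0 k = shape_param (\<epsilon> k) (cc_data (second_diff f0) k) (nucc \<epsilon> f0 k)"

definition nucc_level_mask :: "(nat \<Rightarrow> int \<Rightarrow> real) \<Rightarrow> (int \<Rightarrow> real) \<Rightarrow> nat \<Rightarrow> int \<Rightarrow> int \<Rightarrow> real" where
  "nucc_level_mask \<epsilon> f0 k = nucc_mask k (\<epsilon> k) (cc_data (second_diff f0) k) (nucc \<epsilon> f0 k)"

text \<open>
  Where a datum vanishes, the sign of \<open>\<epsilon>\<close> is free, and may be chosen for each
  shape parameter separately.
\<close>

definition nucc_eps :: "nat \<Rightarrow> (nat \<Rightarrow> int \<Rightarrow> real) \<Rightarrow> (int \<Rightarrow> real) \<Rightarrow> bool" where
  "nucc_eps k0 \<epsilon> f0 \<longleftrightarrow>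
     (\<forall>k l. \<bar>\<epsilon> k l\<bar> = 1 / 2 ^ (2 * k0) \<and>
        (nucc \<epsilon> f0 k (data_index l) \<noteq> 0 \<longrightarrow> sgn (\<epsilon> k l) = sgn (nucc \<epsilon> f0 k (data_index l))))"

definition nucc_standing :: "(nat \<Rightarrow> int \<Rightarrow> real) \<Rightarrow> (int \<Rightarrow> real) \<Rightarrow> bool" where
  "nucc_standing \<epsilon> f0 \<longleftrightarrow>
     (\<exists>B. \<forall>k l. cmod (nucc_shape \<epsilon> f0 k l) \<le> B) \<and>
     (\<forall>k j. \<forall>n\<in>{-2, -1, 0, 1}.
        cc_mask n - 1 / 4 < nucc_level_mask \<epsilon> f0 k j n \<and>
        nucc_level_mask \<epsilon> f0 k j n < cc_mask n + 1 / 4)"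

text \<open>
  The supremum is taken in \<open>ennreal\<close>, where it is 0 if no index lies in \<open>2\<^sup>k\<Omega>\<close>.
\<close>

definition is_limit_function :: "nat \<Rightarrow> (nat \<Rightarrow> int \<Rightarrow> real) \<Rightarrow> (real \<Rightarrow> real) \<Rightarrow> bool" where
  "is_limit_function k0 F g \<longleftrightarrow>
     continuous_on UNIV g \<and>
     (\<forall>\<Omega>. compact \<Omega> \<longrightarrow>
        (\<lambda>k. SUP j\<in>{j. real_of_int j \<in> (\<lambda>x. 2 ^ k * x) ` \<Omega>}.
               ennreal \<bar>F k j - g (grid k j / 2 ^ k0)\<bar>) \<longlonglongrightarrow> 0)"

end

theory Submission
  imports Defs
begin

text \<open>
  Write \<open>h = 1 / 2 ^ k0\<close> for the initial mesh size, \<open>F k j\<close> for the data of the scheme and \<open>G k j\<close>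
  for the samples of \<open>f\<close> at the points \<open>pt k j\<close> to which these data belong. The proof estimates
  \<open>F - G\<close> level by level.

  One step of the scheme inserts, at distance \<open>1/4\<close> of the current mesh size from a point \<open>x\<close>, a
  combination of the datum at \<open>x\<close> and of one neighbour, with weights
  \<open>sinh (3/4 z) / sinh z\<close> and \<open>sinh (1/4 z) / sinh z\<close>. Only \<open>w = z\<^sup>2\<close> matters, which is real, and
  \<open>sinh (c z) / sinh z = c + c (c\<^sup>2 - 1) / 6 * w + O(w\<^sup>2)\<close>. Summing the two first order terms, the
  scheme changes the corner-cutting value by about \<open>- 3/32 * w f(x)\<close>, whereas linear interpolation of
  \<open>f\<close> on a mesh of size \<open>s\<close> needs the correction \<open>- 3/32 * s\<^sup>2 f''(x)\<close>. The shape parameter is designed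
  so that \<open>w f(x)\<close> is close to \<open>s\<^sup>2 f''(x)\<close>: corner cutting of the second differences of the samples
  yields \<open>h\<^sup>2 f'' + O(h\<^sup>3)\<close> at every level. Hence the local defect at level \<open>k\<close> is \<open>O(h\<^sup>3 / 2 ^ k)\<close>, the
  step amplifies errors by a factor \<open>1 + O(1 / 2 ^ k)\<close>, and a discrete Gronwall argument
  (\<open>discrete_gronwall\<close>) sums this to \<open>O(h\<^sup>3)\<close>.

  Two points need care. The quotient \<open>w\<close> contains the computed data \<open>F\<close>, not \<open>f\<close>, so a
  lower bound on \<open>\<bar>F\<bar>\<close> is needed before the expansion can be used. It comes from the
  estimate \<open>F - G = O(h)\<close> of \<open>coarse_error\<close>, which holds everywhere, even at zeros of \<open>f\<close>, because the
  regularization forces \<open>\<bar>w\<bar> = O(1 / 4 ^ k)\<close> and \<open>\<bar>w F\<bar> = O(h\<^sup>2 / 4 ^ k)\<close> uniformly in \<open>k0\<close>. Secondly, the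
  lower bound on \<open>\<bar>f\<bar>\<close> is needed on the whole domain of dependence of the point \<open>tbar\<close>, of radius at most
  \<open>3 h\<close>, however small the interval in the hypothesis. Since \<open>f\<close> is Lipschitz, \<open>\<bar>f tbar\<bar> \<ge> \<tau>\<close> suffices
  if \<open>h\<close> is small compared with \<open>\<tau>\<close> (\<open>fine_error\<close>); if it is not, the estimate \<open>O(h)\<close> is already an
  estimate \<open>O(h\<^sup>3)\<close> with a constant depending on \<open>\<tau>\<close> (\<open>cubic_error\<close>). The values at levels
  \<open>k \<rightarrow> \<infinity>\<close> next to \<open>tbar\<close> finally carry the estimate over to the limit function
  (\<open>limit_function_error\<close>).
\<close>

section \<open>Classical regularity of Sobolev functions\<close>

lemma primitive_lipschitz:
  fixes u v :: "real \<Rightarrow> real"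
  assumes meas: "v \<in> borel_measurable lborel" and bound: "AE x in lborel. \<bar>v x\<bar> \<le> K"
    and prim: "\<And>a b. a \<le> b \<Longrightarrow> u b - u a = (LINT x:{a..b}|lborel. v x)"
  shows "\<bar>u x - u y\<bar> \<le> K * \<bar>x - y\<bar>"
proof -
  have *: "\<bar>u b - u a\<bar> \<le> K * (b - a)" if "a \<le> b" for a b
  proof -
    have "set_integrable lborel {a..b} v"
      unfolding set_integrable_def
      by (rule integrableI_bounded_set_indicator[where B = K]) (use meas bound in \<open>auto simp: emeasure_lborel_Icc_eq elim!: eventually_mono\<close>)
    moreover have c: "set_integrable lborel {a..b} (\<lambda>_. C)" for C :: real
      unfolding set_integrable_def by (rule integrableI_bounded_set_indicator[where B = "\<bar>C\<bar>"])
        (auto simp: emeasure_lborel_Icc_eq)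
    moreover have "AE x\<in>{a..b} in lborel. v x \<le> K" "AE x\<in>{a..b} in lborel. -K \<le> v x"
      using bound by (auto elim!: eventually_mono)
    ultimately have "(LINT x:{a..b}|lborel. v x) \<le> (LINT x:{a..b}|lborel. K)"
      "(LINT x:{a..b}|lborel. -K) \<le> (LINT x:{a..b}|lborel. v x)"
      by (auto intro!: set_integral_mono_AE)
    moreover have "(LINT x:{a..b}|lborel. C) = C * (b - a)" for C :: real
      using that by (simp add: set_lebesgue_integral_def)
    ultimately show ?thesis
      unfolding prim[OF that] by (auto simp: abs_le_iff algebra_simps)
  qed
  show ?thesis
  proof (cases "x \<le> y")
    case True
    then show ?thesis using *[of x y] by (simp add: abs_minus_commute)
  next
    case False
    then show ?thesis using *[of y x] by simp
  qed
qed

lemma primitive_has_derivative: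
  fixes u v :: "real \<Rightarrow> real"
  assumes cont: "continuous_on UNIV v"
    and prim: "\<And>a b. a \<le> b \<Longrightarrow> u b - u a = (LINT x:{a..b}|lborel. v x)"
  shows "(u has_real_derivative v x) (at x)"
proof -
  have c: "continuous_on S v" for S using cont continuous_on_subset by blast
  have "((\<lambda>t. integral {x - 1..t} v) has_real_derivative v x) (at x within {x - 1..x + 1})"
    by (rule integral_has_real_derivative[OF c]) simp
  then have "((\<lambda>t. u (x - 1) + integral {x - 1..t} v) has_real_derivative v x) (at x within {x - 1..x + 1})"
    by (auto intro!: derivative_eq_intros)
  moreover have "u (x - 1) + integral {x - 1..t} v = u t" if "x - 1 \<le> t" for t
  proof -
    have "set_integrable lborel {x - 1..t} v"
      by (rule borel_integrable_atLeastAtMost'[OF c])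
    from set_borel_integral_eq_integral(2)[OF this] show ?thesis using prim[OF that] by simp
  qed
  ultimately have "(u has_real_derivative v x) (at x within {x - 1..x + 1})"
    by (subst has_field_derivative_cong_eventually[symmetric]) (auto simp: eventually_at_filter)
  then show ?thesis by (simp add: at_within_Icc_at)
qed

lemma lipschitz_imp_continuous:
  fixes u :: "real \<Rightarrow> real"
  assumes "\<And>x y. \<bar>u x - u y\<bar> \<le> K * \<bar>x - y\<bar>"
  shows "continuous_on UNIV u"
proof -
  have "K \<ge> 0" using assms[of 1 0] by simp
  then have "K-lipschitz_on UNIV u" using assms by (auto intro!: lipschitz_onI simp: dist_real_def)
  then show ?thesis by (rule lipschitz_on_continuous_on)
qed

lemma AE_bound_imp_bound:
  fixes u :: "real \<Rightarrow> real"
  assumes "continuous_on UNIV u" and "AE x in lborel. \<bar>u x\<bar> \<le> K"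
  shows "\<bar>u x\<bar> \<le> K"
proof -
  have "closed {x. \<bar>u x\<bar> \<le> K}" using assms(1) by (intro closed_Collect_le continuous_intros) auto
  moreover have "AE x in lebesgue. x \<in> {x. \<bar>u x\<bar> \<le> K}" using AE_completion[OF assms(2)] by simp
  ultimately have "x \<in> {x. \<bar>u x\<bar> \<le> K}" by (rule mem_closed_if_AE_lebesgue)
  then show ?thesis by simp
qed

text \<open>
  The mean value theorem is applied twice; this loses the constant \<open>1/6\<close> of the sharp
  remainder but only uses that \<open>f2\<close> is Lipschitz.
\<close>

lemma second_order_remainder:
  fixes f f1 f2 :: "real \<Rightarrow> real"
  assumes d1: "\<And>x. (f has_real_derivative f1 x) (at x)"
    and d2: "\<And>x. (f1 has_real_derivative f2 x) (at x)"
    and lip: "\<And>x y. \<bar>f2 x - f2 y\<bar> \<le> M * \<bar>x - y\<bar>"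
  shows "\<bar>f (x + s) - (f x + f1 x * s + f2 x * s\<^sup>2 / 2)\<bar> \<le> M * \<bar>s\<bar> ^ 3"
proof (cases "s = 0")
  case False
  have M: "M \<ge> 0" using lip[of 1 0] by simp
  have r1: "\<bar>f1 (x + t) - f1 x - f2 x * t\<bar> \<le> M * \<bar>s\<bar>\<^sup>2" if "\<bar>t\<bar> \<le> \<bar>s\<bar>" for t
  proof -
    have "\<exists>\<xi>. \<bar>\<xi> - x\<bar> \<le> \<bar>t\<bar> \<and> f1 (x + t) - f1 x = f2 \<xi> * t"
    proof (rule linorder_cases[of t 0])
      assume "t < 0"
      then obtain z where z: "x + t < z" "z < x" "f1 x - f1 (x + t) = (x - (x + t)) * f2 z"
        using MVT2[of "x + t" x f1 f2] d2 by auto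
      then show ?thesis by (intro exI[of _ z]) (auto simp: algebra_simps)
    next
      assume "t > 0"
      then obtain z where z: "x < z" "z < x + t" "f1 (x + t) - f1 x = (x + t - x) * f2 z"
        using MVT2[of x "x + t" f1 f2] d2 by auto
      then show ?thesis by (intro exI[of _ z]) (auto simp: algebra_simps)
    qed (auto intro!: exI[of _ x])
    then obtain \<xi> where \<xi>: "\<bar>\<xi> - x\<bar> \<le> \<bar>t\<bar>" "f1 (x + t) - f1 x = f2 \<xi> * t" by auto
    have "\<bar>f1 (x + t) - f1 x - f2 x * t\<bar> = \<bar>f2 \<xi> - f2 x\<bar> * \<bar>t\<bar>"
      using \<xi>(2) by (simp add: algebra_simps flip: abs_mult)
    also have "\<dots> \<le> (M * \<bar>s\<bar>) * \<bar>s\<bar>"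
    proof (intro mult_mono)
      have "\<bar>f2 \<xi> - f2 x\<bar> \<le> M * \<bar>\<xi> - x\<bar>" by (rule lip)
      also have "\<dots> \<le> M * \<bar>s\<bar>" using \<xi>(1) that M by (intro mult_left_mono) auto
      finally show "\<bar>f2 \<xi> - f2 x\<bar> \<le> M * \<bar>s\<bar>" .
    qed (use that M in auto)
    finally show ?thesis by (simp add: power2_eq_square)
  qed
  define \<phi> where "\<phi> t = f (x + t) - (f x + f1 x * t + f2 x * t\<^sup>2 / 2)" for t
  have d\<phi>: "(\<phi> has_real_derivative (f1 (x + t) - f1 x - f2 x * t)) (at t)" for t
  proof -
    have "((\<lambda>t. f (x + t)) has_real_derivative f1 (x + t)) (at t)"
      using d1[of "x + t"] DERIV_shift[of f "f1 (x + t)" t x] by (simp add: add.commute)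
    then show ?thesis
      unfolding \<phi>_def by (auto intro!: derivative_eq_intros)
  qed
  have "\<exists>\<xi>. \<bar>\<xi>\<bar> \<le> \<bar>s\<bar> \<and> \<phi> s - \<phi> 0 = (f1 (x + \<xi>) - f1 x - f2 x * \<xi>) * s"
  proof (cases "s > 0")
    case True
    then obtain z where "0 < z" "z < s" "\<phi> s - \<phi> 0 = (s - 0) * (f1 (x + z) - f1 x - f2 x * z)"
      using MVT2[OF _ d\<phi>, of 0 s] by auto
    then show ?thesis by (intro exI[of _ z]) auto
  next
    case s: False
    then obtain z where "s < z" "z < 0" "\<phi> 0 - \<phi> s = (0 - s) * (f1 (x + z) - f1 x - f2 x * z)"
      using MVT2[OF _ d\<phi>, of s 0] False by auto
    then show ?thesis by (intro exI[of _ z]) (auto simp: algebra_simps)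
  qed
  then obtain \<xi> where \<xi>: "\<bar>\<xi>\<bar> \<le> \<bar>s\<bar>" "\<phi> s - \<phi> 0 = (f1 (x + \<xi>) - f1 x - f2 x * \<xi>) * s" by auto
  have "\<bar>\<phi> s\<bar> = \<bar>f1 (x + \<xi>) - f1 x - f2 x * \<xi>\<bar> * \<bar>s\<bar>"
    using \<xi>(2) by (simp add: \<phi>_def abs_mult)
  also have "\<dots> \<le> (M * \<bar>s\<bar>\<^sup>2) * \<bar>s\<bar>" using r1[OF \<xi>(1)] by (intro mult_right_mono) auto
  also have "\<dots> = M * \<bar>s\<bar> ^ 3" by (simp add: eval_nat_numeral)
  finally show ?thesis by (simp add: \<phi>_def)
qed simp

text \<open>
  What the error analysis uses of the hypothesis on \<open>f\<close>. An essential bound on the third derivative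
  makes the second one Lipschitz, and essential bounds on the continuous lower derivatives hold everywhere.
\<close>

lemma sobolev_inf_3_classical:
  assumes "f \<in> sobolev_inf 3"
  obtains f1 f2 :: "real \<Rightarrow> real" and M :: real where
    "M \<ge> 1" "\<And>x. \<bar>f x\<bar> \<le> M" "\<And>x. \<bar>f2 x\<bar> \<le> M"
    "\<And>x y. \<bar>f x - f y\<bar> \<le> M * \<bar>x - y\<bar>" "\<And>x y. \<bar>f2 x - f2 y\<bar> \<le> M * \<bar>x - y\<bar>"
    "\<And>x s. \<bar>f (x + s) - (f x + f1 x * s + f2 x * s\<^sup>2 / 2)\<bar> \<le> M * \<bar>s\<bar> ^ 3"
proof -
  obtain D :: "nat \<Rightarrow> real \<Rightarrow> real" where D0: "D 0 = f"
    and meas: "\<And>n. n \<le> 3 \<Longrightarrow> D n \<in> borel_measurable lborel"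
    and prim: "\<And>n a b. n < 3 \<Longrightarrow> a \<le> b \<Longrightarrow> D n b - D n a = (LINT x:{a..b}|lborel. D (Suc n) x)"
    and fin: "(\<Sum>n\<le>3. esssup lborel (\<lambda>x. ereal \<bar>D n x\<bar>)) < \<infinity>"
    using assms unfolding sobolev_inf_def by auto
  have "\<exists>K. AE x in lborel. \<bar>D n x\<bar> \<le> K" if "n \<le> 3" for n
  proof -
    let ?s = "esssup lborel (\<lambda>x. ereal \<bar>D n x\<bar>)"
    have "?s \<noteq> \<infinity>"
      using fin that by (auto simp: sum_Pinfty less_top[symmetric] top_ereal_def)
    then obtain K where "?s \<le> ereal K" by (cases ?s) auto
    then have "AE x in lborel. \<bar>D n x\<bar> \<le> K"
      using esssup_AE[of "\<lambda>x. ereal \<bar>D n x\<bar>" lborel]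
      by (auto elim!: eventually_mono dest!: order.trans[of _ ?s])
    then show ?thesis ..
  qed
  then obtain K where K: "\<And>n. n \<le> 3 \<Longrightarrow> AE x in lborel. \<bar>D n x\<bar> \<le> K n" by metis
  define M where "M = Max (insert 1 (K ` {..3}))"
  have M1: "M \<ge> 1" unfolding M_def by (rule Max_ge) auto
  have KM: "K n \<le> M" if "n \<le> 3" for n unfolding M_def by (rule Max_ge) (use that in auto)
  have AE: "AE x in lborel. \<bar>D n x\<bar> \<le> M" if "n \<le> 3" for n
    using K[OF that] KM[OF that] by (auto elim!: eventually_mono)
  have lip: "\<bar>D n x - D n y\<bar> \<le> M * \<bar>x - y\<bar>" if "n < 3" for n x y
    by (rule primitive_lipschitz[OF meas AE prim]) (use that in auto)
  have cont: "continuous_on UNIV (D n)" if "n < 3" for n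
    by (rule lipschitz_imp_continuous[OF lip[OF that]])
  have bd: "\<bar>D n x\<bar> \<le> M" if "n < 3" for n x
    by (rule AE_bound_imp_bound[OF cont AE]) (use that in auto)
  have der: "(D n has_real_derivative D (Suc n) x) (at x)" if "Suc n < 3" for n x
    by (rule primitive_has_derivative[OF cont prim]) (use that in auto)
  show thesis
  proof (rule that[of M "D 2" "D 1"])
    show "\<bar>f (x + s) - (f x + D 1 x * s + D 2 x * s\<^sup>2 / 2)\<bar> \<le> M * \<bar>s\<bar> ^ 3" for x s
      by (rule second_order_remainder)
        (use der[of 0] der[of 1] lip[of 2] D0 in \<open>auto simp: numeral_2_eq_2\<close>)
  qed (use M1 bd[of 0] bd[of 2] lip[of 0] lip[of 2] D0 in auto)
qed

section \<open>One step of the scheme\<close>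

lemma subdiv_two_terms:
  assumes "\<And>n. n \<notin> {-2, -1, 0, 1} \<Longrightarrow> a (l div 2) n = 0"
  shows "subdiv a g l = a (l div 2) (l mod 2) * g (l div 2)
           + a (l div 2) (l mod 2 - 2) * g (l div 2 + 1)"
proof -
  have "a (l div 2) (2 * i + l mod 2) = 0" if "i \<notin> {-1, 0}" for i
  proof (rule assms)
    have "l mod 2 = 0 \<or> l mod 2 = 1" by presburger
    then show "2 * i + l mod 2 \<notin> {-2, -1, 0, 1}" using that by auto
  qed
  then have "subdiv a g l
      = (\<Sum>\<^sub>\<infinity>i\<in>{-1, 0}. a (l div 2) (2 * i + l mod 2) * g (l div 2 - i))"
    unfolding subdiv_def by (intro infsum_cong_neutral) auto
  then show ?thesis by (simp add: algebra_simps)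
qed

text \<open>
  Both rules, \<open>\<nu> = 0\<close> and \<open>\<nu> = 1\<close>, have one form when written relative to the index
  \<open>data_index l\<close> that determines the shape parameter: the new point lies a quarter of the mesh size to
  the right or to the left of that point, the neighbour involved lies on the same side, and the datum at
  \<open>data_index l\<close> gets the larger weight. The sign \<open>side l\<close> is the only difference.
\<close>

definition side :: "int \<Rightarrow> int" where
  "side l = (if even l then 1 else -1)"

lemma nucc_Suc:
  "nucc \<epsilon> f0 (Suc k) l =
     sinh_ratio (3 / 4) (nucc_shape \<epsilon> f0 k l / 2 ^ k) * nucc \<epsilon> f0 k (data_index l)
   + sinh_ratio (1 / 4) (nucc_shape \<epsilon> f0 k l / 2 ^ k) * nucc \<epsilon> f0 k (data_index l + side l)"
proof -
  define a where "a = nucc_mask k (\<epsilon> k) (cc_data (second_diff f0) k) (nucc \<epsilon> f0 k)"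
  have "nucc \<epsilon> f0 (Suc k) l = subdiv a (nucc \<epsilon> f0 k) l" by (simp add: a_def)
  also have "\<dots> = a (l div 2) (l mod 2) * nucc \<epsilon> f0 k (l div 2)
           + a (l div 2) (l mod 2 - 2) * nucc \<epsilon> f0 k (l div 2 + 1)"
    by (rule subdiv_two_terms) (auto simp: a_def nucc_mask_def)
  finally have S: "nucc \<epsilon> f0 (Suc k) l = a (l div 2) (l mod 2) * nucc \<epsilon> f0 k (l div 2)
           + a (l div 2) (l mod 2 - 2) * nucc \<epsilon> f0 k (l div 2 + 1)" .
  show ?thesis
  proof (cases "even l")
    case True
    then obtain i where "l = 2 * i" by auto
    then show ?thesis unfolding S
      by (simp add: a_def nucc_mask_def side_def data_index_def nucc_shape_def)
  next
    case False
    then obtain i where "l = 2 * i + 1" by (auto elim: oddE)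
    then show ?thesis unfolding S
      by (simp add: a_def nucc_mask_def side_def data_index_def nucc_shape_def)
  qed
qed

lemma cc_data_Suc:
  "cc_data d0 (Suc k) l =
     3 / 4 * cc_data d0 k (data_index l) + 1 / 4 * cc_data d0 k (data_index l + side l)"
proof -
  have "cc_data d0 (Suc k) l = subdiv (\<lambda>_. cc_mask) (cc_data d0 k) l" by (simp add: cc_data_def)
  also have "\<dots> = cc_mask (l mod 2) * cc_data d0 k (l div 2)
           + cc_mask (l mod 2 - 2) * cc_data d0 k (l div 2 + 1)"
    by (rule subdiv_two_terms) (auto simp: cc_mask_def)
  finally have S: "cc_data d0 (Suc k) l = cc_mask (l mod 2) * cc_data d0 k (l div 2)
           + cc_mask (l mod 2 - 2) * cc_data d0 k (l div 2 + 1)" .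
  show ?thesis
  proof (cases "even l")
    case True
    then show ?thesis unfolding S
      by (simp add: cc_mask_def side_def data_index_def even_iff_mod_2_eq_zero)
  next
    case False
    then obtain i where "l = 2 * i + 1" by (auto elim: oddE)
    then show ?thesis unfolding S
      by (simp add: cc_mask_def side_def data_index_def)
  qed
qed

lemma grid_Suc: "grid (Suc k) l = grid k (data_index l) + real_of_int (side l) / (4 * 2 ^ k)"
proof (cases "even l")
  case True
  then obtain i where "l = 2 * i" by auto
  then show ?thesis by (simp add: grid_def data_index_def side_def field_simps)
next
  case False
  then obtain i where "l = 2 * i + 1" by (auto elim: oddE)
  then show ?thesis by (simp add: grid_def data_index_def side_def field_simps)
qed

lemma grid_neighbour: "grid k (i + j) = grid k i + real_of_int j / 2 ^ k"
  by (simp add: grid_def field_simps)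

section \<open>Expansion of the hyperbolic mask entries\<close>

lemma sinh_taylor:
  fixes z :: complex
  assumes "cmod z \<le> 1"
  shows "cmod (sinh z - (z + z ^ 3 / 6)) \<le> cmod z ^ 5 / 8"
proof -
  have e: "cmod (exp u - (\<Sum>i\<le>4. u ^ i / fact i)) \<le> cmod z ^ 5 / 8"
    if "cmod u = cmod z" for u :: complex
  proof -
    have "cmod (exp u - (\<Sum>i\<le>4. u ^ i / fact i)) \<le> exp (cmod u) * cmod u ^ Suc 4 / fact 4"
      by (rule Taylor_exp_field)
    also have "\<dots> \<le> 3 * cmod z ^ 5 / 24"
    proof -
      have "exp (cmod u) \<le> exp 1" using assms that by simp
      also have "\<dots> \<le> 3" using exp_le by simp
      finally have "exp (cmod u) * cmod z ^ 5 \<le> 3 * cmod z ^ 5" by (intro mult_right_mono) auto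
      then show ?thesis using that by (simp add: fact_numeral)
    qed
    finally show ?thesis by simp
  qed
  have "sinh z - (z + z ^ 3 / 6)
      = ((exp z - (\<Sum>i\<le>4. z ^ i / fact i)) - (exp (- z) - (\<Sum>i\<le>4. (- z) ^ i / fact i))) / 2"
    by (simp add: sinh_field_def fact_numeral eval_nat_numeral field_simps)
  also have "cmod \<dots> \<le> (cmod z ^ 5 / 8 + cmod z ^ 5 / 8) / 2"
    using norm_triangle_ineq4[of "exp z - (\<Sum>i\<le>4. z ^ i / fact i)" "exp (- z) - (\<Sum>i\<le>4. (- z) ^ i / fact i)"]
      e[of z] e[of "-z"] by (simp add: norm_divide)
  finally show ?thesis by simp
qed

text \<open>
  With \<open>P\<close> the claimed expansion, the terms of order up to 3 in
  \<open>sinh (c z) - P sinh z\<close> cancel, and \<open>\<bar>sinh z\<bar> \<ge> \<bar>z\<bar> / 2\<close> in the unit disc.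
  Arguing with complex \<open>z\<close> treats real and imaginary shape parameters at once.
\<close>

lemma sinh_ratio_second_order_small:
  fixes z :: complex
  assumes z: "z\<^sup>2 = of_real w" and w: "\<bar>w\<bar> \<le> 1" and c: "0 \<le> c" "c \<le> 1"
  shows "\<bar>sinh_ratio c z - (c + c * (c\<^sup>2 - 1) / 6 * w)\<bar> \<le> w\<^sup>2"
proof (cases "z = 0")
  case True
  then show ?thesis using z by (simp add: sinh_ratio_def)
next
  case False
  define r where "r = cmod z"
  define P :: complex where "P = of_real c + of_real (c * (c\<^sup>2 - 1) / 6) * z\<^sup>2"
  have rw: "r\<^sup>2 = \<bar>w\<bar>"
    unfolding r_def by (simp add: norm_power[symmetric] z)
  then have "r\<^sup>2 \<le> 1" using w by simp
  moreover have r0: "r > 0" using False by (simp add: r_def)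
  ultimately have r1: "r \<le> 1" by (simp add: power_le_one_iff)
  have c2: "c\<^sup>2 \<le> 1" using c by (simp add: power_le_one)
  have cc: "\<bar>c * (c\<^sup>2 - 1)\<bar> \<le> 1"
  proof -
    have "\<bar>c * (c\<^sup>2 - 1)\<bar> = c * (1 - c\<^sup>2)" using c c2 by (simp add: abs_mult)
    also have "\<dots> \<le> 1 * 1" using c c2 by (intro mult_mono) auto
    finally show ?thesis by simp
  qed
  define R1 where "R1 = sinh (of_real c * z) - (of_real c * z + (of_real c * z) ^ 3 / 6)"
  define R2 where "R2 = sinh z - (z + z ^ 3 / 6)"
  have R2: "cmod R2 \<le> r ^ 5 / 8" unfolding R2_def r_def by (rule sinh_taylor) (use r1 r_def in auto)
  have cz: "cmod (of_real c * z) \<le> r" using c r0 by (simp add: norm_mult r_def mult_left_le_one_le)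
  have "cmod R1 \<le> cmod (of_real c * z) ^ 5 / 8" unfolding R1_def by (rule sinh_taylor) (use cz r1 in auto)
  also have "\<dots> \<le> r ^ 5 / 8" using cz by (intro divide_right_mono power_mono) auto
  finally have R1: "cmod R1 \<le> r ^ 5 / 8" .
  have P: "cmod P \<le> 2"
  proof -
    have "cmod P \<le> \<bar>c\<bar> + \<bar>c * (c\<^sup>2 - 1) / 6\<bar> * \<bar>w\<bar>"
      unfolding P_def z by (rule order.trans[OF norm_triangle_ineq]) (simp add: norm_mult del: of_real_mult of_real_divide)
    also have "\<dots> \<le> 1 + (1 / 6) * 1" using c cc w by (intro add_mono mult_mono) auto
    finally show ?thesis by simp
  qed
  have N: "sinh (of_real c * z) - P * sinh z
      = R1 - P * R2 - of_real (c * (c\<^sup>2 - 1) / 36) * z ^ 5"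
    unfolding R1_def R2_def P_def by (simp add: field_simps eval_nat_numeral)
  have "cmod (sinh (of_real c * z) - P * sinh z)
      \<le> cmod R1 + cmod P * cmod R2 + \<bar>c * (c\<^sup>2 - 1) / 36\<bar> * r ^ 5"
    unfolding N
    by (rule order.trans[OF norm_triangle_ineq4] add_mono)+ (auto simp: norm_mult norm_power r_def simp flip: of_real_mult)
  also have "\<dots> \<le> r ^ 5 / 8 + 2 * (r ^ 5 / 8) + 1 / 36 * r ^ 5"
    using R1 R2 P cc r0 by (intro add_mono mult_mono) auto
  also have "\<dots> \<le> r ^ 5 / 2" using r0 by simp
  finally have num: "cmod (sinh (of_real c * z) - P * sinh z) \<le> r ^ 5 / 2" .
  have den: "cmod (sinh z) \<ge> r / 2"
  proof -
    have "r = cmod (sinh z - z ^ 3 / 6 - R2)" by (simp add: R2_def r_def)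
    also have "\<dots> \<le> cmod (sinh z) + r ^ 3 / 6 + r ^ 5 / 8"
      using R2 norm_triangle_ineq4[of "sinh z - z ^ 3 / 6" R2] norm_triangle_ineq4[of "sinh z" "z ^ 3 / 6"]
      by (simp add: norm_divide norm_power r_def)
    finally have "r \<le> cmod (sinh z) + r ^ 3 / 6 + r ^ 5 / 8" .
    moreover have "r ^ 3 \<le> r" "r ^ 5 \<le> r"
      using power_decreasing[of 1 3 r] power_decreasing[of 1 5 r] r0 r1 by auto
    ultimately show ?thesis using r0 by linarith
  qed
  have s0: "sinh z \<noteq> 0" using den r0 by auto
  have Pr: "P = of_real (c + c * (c\<^sup>2 - 1) / 6 * w)" by (simp add: P_def z)
  have "\<bar>sinh_ratio c z - (c + c * (c\<^sup>2 - 1) / 6 * w)\<bar>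
      = \<bar>Re (sinh (of_real c * z) / sinh z - P)\<bar>"
    using False by (simp add: sinh_ratio_def Pr)
  also have "\<dots> \<le> cmod (sinh (of_real c * z) / sinh z - P)" by (rule abs_Re_le_cmod)
  also have "\<dots> = cmod (sinh (of_real c * z) - P * sinh z) / cmod (sinh z)"
    using s0 by (simp add: field_simps flip: norm_divide)
  also have "\<dots> \<le> (r ^ 5 / 2) / (r / 2)"
    using num den r0 by (intro frac_le) auto
  also have "\<dots> = (r\<^sup>2)\<^sup>2" using r0 by (simp add: eval_nat_numeral)
  finally show ?thesis by (simp add: rw)
qed

text \<open>
  For imaginary \<open>z\<close> the quotient has poles, so no such estimate holds without restriction; the assumed
  closeness to \<open>c\<close> is what makes it true for all \<open>w\<close>, because
  for \<open>\<bar>w\<bar> > 1\<close> the quantities to be estimated are bounded trivially.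
\<close>

lemma sinh_ratio_second_order:
  fixes z :: complex
  assumes z: "z\<^sup>2 = of_real w" and c: "0 \<le> c" "c \<le> 1" and near: "\<bar>sinh_ratio c z - c\<bar> \<le> 1 / 4"
  shows "\<bar>sinh_ratio c z - (c + c * (c\<^sup>2 - 1) / 6 * w)\<bar> \<le> w\<^sup>2" (is ?second)
    and "\<bar>sinh_ratio c z - c\<bar> \<le> 2 * \<bar>w\<bar>" (is ?first)
proof -
  have "c\<^sup>2 \<le> 1" using c by (simp add: power_le_one)
  then have "\<bar>c * (c\<^sup>2 - 1)\<bar> \<le> 1 * 1"
    unfolding abs_mult using c by (intro mult_mono) auto
  then have "\<bar>c * (c\<^sup>2 - 1)\<bar> * (\<bar>w\<bar> / 6) \<le> 1 * (\<bar>w\<bar> / 6)" by (intro mult_right_mono) auto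
  then have k: "\<bar>c * (c\<^sup>2 - 1) / 6 * w\<bar> \<le> \<bar>w\<bar> / 6" by (simp add: abs_mult)
  have "?second \<and> ?first"
  proof (cases "\<bar>w\<bar> \<le> 1")
    case True
    have "w\<^sup>2 \<le> \<bar>w\<bar>"
      using True mult_left_le_one_le[of "\<bar>w\<bar>" "\<bar>w\<bar>"] by (simp add: power2_eq_square flip: abs_mult)
    then show ?thesis
      using sinh_ratio_second_order_small[OF z True c] k by linarith
  next
    case False
    then have "\<bar>w\<bar> \<le> w\<^sup>2"
      using mult_right_mono[of 1 "\<bar>w\<bar>" "\<bar>w\<bar>"] by (simp add: power2_eq_square flip: abs_mult)
    then show ?thesis using near k False by linarith
  qed
  then show ?second ?first by auto
qed

section \<open>Accumulation of errors over the levels\<close>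

text \<open>
  The sets \<open>W k\<close> are domains of dependence: an error on \<open>W (k + 1)\<close> is controlled by the errors on
  \<open>W k\<close>. The bound carried through the induction is \<open>D / A * (P k - 1)\<close>, where
  \<open>P k = exp (A * (\<Sum>i<k. 1 / 2 ^ i))\<close> dominates the product of the amplification factors.
\<close>

lemma discrete_gronwall:
  fixes e :: "nat \<Rightarrow> 'a \<Rightarrow> real" and A D :: real
  assumes "A > 0" "D \<ge> 0" and init: "\<And>j. j \<in> W 0 \<Longrightarrow> e 0 j \<le> 0"
    and step: "\<And>k j B. B \<ge> 0 \<Longrightarrow> (\<And>i. i \<in> W k \<Longrightarrow> e k i \<le> B) \<Longrightarrow> j \<in> W (Suc k) \<Longrightarrow>
                 e (Suc k) j \<le> (1 + A / 2 ^ k) * B + D / 2 ^ k"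
    and j: "j \<in> W k"
  shows "e k j \<le> D / A * exp (2 * A)"
proof -
  define P where "P k = exp (A * (2 - 2 / 2 ^ k))" for k :: nat
  have P1: "P k \<ge> 1" for k
  proof -
    have "(1::real) \<le> 2 ^ k" by simp
    then have "2 / 2 ^ k \<le> (2::real)" by (simp add: divide_le_eq)
    then show ?thesis unfolding P_def using \<open>A > 0\<close> by simp
  qed
  have PS: "(1 + A / 2 ^ k) * P k \<le> P (Suc k)" for k
  proof -
    have "P (Suc k) = P k * exp (A / 2 ^ k)"
      unfolding P_def exp_add[symmetric] by (simp add: field_simps)
    then show ?thesis
      using mult_right_mono[OF exp_ge_add_one_self[of "A / 2 ^ k"], of "P k"] P1[of k] by (simp add: mult.commute)
  qed
  have "\<forall>j\<in>W k. e k j \<le> D / A * (P k - 1)"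
  proof (induction k)
    case 0
    then show ?case using init by (simp add: P_def)
  next
    case (Suc k)
    have nn: "D / A * (P k - 1) \<ge> 0" using assms(1,2) P1[of k] by simp
    show ?case
    proof
      fix j assume "j \<in> W (Suc k)"
      then have "e (Suc k) j \<le> (1 + A / 2 ^ k) * (D / A * (P k - 1)) + D / 2 ^ k"
        using step[OF nn] Suc.IH by blast
      also have "\<dots> = D / A * ((1 + A / 2 ^ k) * P k - 1)"
        using \<open>A > 0\<close> by (simp add: field_simps)
      also have "\<dots> \<le> D / A * (P (Suc k) - 1)"
        using PS[of k] assms(1,2) by (intro mult_left_mono) auto
      finally show "e (Suc k) j \<le> D / A * (P (Suc k) - 1)" .
    qed
  qed
  then have "e k j \<le> D / A * (P k - 1)" using j by blast
  also have "\<dots> \<le> D / A * exp (2 * A)"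
  proof (intro mult_left_mono)
    have "P k \<le> exp (2 * A)" unfolding P_def using \<open>A > 0\<close> by simp
    then show "P k - 1 \<le> exp (2 * A)" by simp
  qed (use assms(1,2) in auto)
  finally show ?thesis .
qed

section \<open>Error analysis\<close>

text \<open>
  Here \<open>M\<close> bounds \<open>f\<close> and its derivatives. The errors are at most \<open>coarse_const M * h\<close> everywhere;
  \<open>defect_const M \<tau> * h ^ 3 / 2 ^ k\<close> bounds what level \<open>k\<close> contributes where \<open>\<bar>F\<bar> \<ge> \<tau> / 2\<close>;
  the two summands of \<open>error_const\<close> serve small and large \<open>h\<close>. All are independent of \<open>k0\<close>.
\<close>

definition coarse_const :: "real \<Rightarrow> real" where
  "coarse_const M = 2 * M * exp (24 * M)"

definition defect_const :: "real \<Rightarrow> real \<Rightarrow> real" where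
  "defect_const M \<tau> =
     (let W = 6 * M / \<tau> in 5 * M + W * (coarse_const M + 1 + M) + 2 * M * W\<^sup>2)"

definition error_const :: "real \<Rightarrow> real \<Rightarrow> real" where
  "error_const M \<tau> = defect_const M \<tau> / (12 * M) * exp (2 * (12 * M))
     + coarse_const M * (2 * (3 * M + coarse_const M) / \<tau>)\<^sup>2"

locale nucc_on_samples =
  fixes f f1 f2 :: "real \<Rightarrow> real" and M :: real and k0 :: nat
    and \<epsilon> :: "nat \<Rightarrow> int \<Rightarrow> real" and f0 :: "int \<Rightarrow> real"
  assumes M1: "M \<ge> 1"
    and f_bound: "\<And>x. \<bar>f x\<bar> \<le> M"
    and f2_bound: "\<And>x. \<bar>f2 x\<bar> \<le> M"
    and f_lip: "\<And>x y. \<bar>f x - f y\<bar> \<le> M * \<bar>x - y\<bar>"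
    and f2_lip: "\<And>x y. \<bar>f2 x - f2 y\<bar> \<le> M * \<bar>x - y\<bar>"
    and taylor: "\<And>x s. \<bar>f (x + s) - (f x + f1 x * s + f2 x * s\<^sup>2 / 2)\<bar> \<le> M * \<bar>s\<bar> ^ 3"
    and f0: "f0 = (\<lambda>n. f ((real_of_int n - 1 / 2) / 2 ^ k0))"
    and eps: "nucc_eps k0 \<epsilon> f0"
    and standing: "nucc_standing \<epsilon> f0"
begin

definition h :: real where "h = 1 / 2 ^ k0"
definition pt :: "nat \<Rightarrow> int \<Rightarrow> real" where "pt k j = grid k j / 2 ^ k0"
definition d :: "nat \<Rightarrow> int \<Rightarrow> real" where "d = cc_data (second_diff f0)"
abbreviation F :: "nat \<Rightarrow> int \<Rightarrow> real" where "F \<equiv> nucc \<epsilon> f0"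
abbreviation G :: "nat \<Rightarrow> int \<Rightarrow> real" where "G k j \<equiv> f (pt k j)"

text \<open>
  The square of the argument of the hyperbolic functions at level \<open>k\<close>.
\<close>

definition w :: "nat \<Rightarrow> int \<Rightarrow> real" where
  "w k l = d k (data_index l) / (F k (data_index l) + \<epsilon> k l) / 4 ^ k"

definition far_weight :: "nat \<Rightarrow> int \<Rightarrow> real" where
  "far_weight k l = sinh_ratio (1 / 4) (nucc_shape \<epsilon> f0 k l / 2 ^ k)"
definition near_weight :: "nat \<Rightarrow> int \<Rightarrow> real" where
  "near_weight k l = sinh_ratio (3 / 4) (nucc_shape \<epsilon> f0 k l / 2 ^ k)"

lemma h: "0 < h" "h \<le> 1"
  by (simp_all add: h_def)

lemma h_power_mono: "m \<le> n \<Longrightarrow> h ^ n \<le> h ^ m"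
  using h by (intro power_decreasing) auto

lemma pt_Suc: "pt (Suc k) l = pt k (data_index l) + real_of_int (side l) * (h * (1 / 2 ^ k)) / 4"
  by (simp add: pt_def h_def grid_Suc add_divide_distrib ac_simps)

lemma pt_neighbour: "pt k (j + i) = pt k j + real_of_int i * (h * (1 / 2 ^ k))"
  by (simp add: pt_def h_def grid_neighbour add_divide_distrib)

lemma side_cases: "side l = 1 \<or> side l = -1"
  by (simp add: side_def)

lemma pt_distances:
  "\<bar>pt k (data_index l) - pt (Suc k) l\<bar> = h * (1 / 2 ^ k) / 4"
  "\<bar>pt k (data_index l + side l) - pt (Suc k) l\<bar> = 3 / 4 * (h * (1 / 2 ^ k))"
  "\<bar>pt k (data_index l + side l) - pt k (data_index l)\<bar> = h * (1 / 2 ^ k)"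
proof -
  have "h * (1 / 2 ^ k) > 0" using h by simp
  then show "\<bar>pt k (data_index l) - pt (Suc k) l\<bar> = h * (1 / 2 ^ k) / 4"
    "\<bar>pt k (data_index l + side l) - pt (Suc k) l\<bar> = 3 / 4 * (h * (1 / 2 ^ k))"
    "\<bar>pt k (data_index l + side l) - pt k (data_index l)\<bar> = h * (1 / 2 ^ k)"
    using side_cases[of l] h unfolding pt_Suc pt_neighbour by auto
qed

lemma F_Suc:
  "F (Suc k) l = near_weight k l * F k (data_index l) + far_weight k l * F k (data_index l + side l)"
  unfolding near_weight_def far_weight_def by (rule nucc_Suc)

lemma F_0: "F 0 j = G 0 j"
  by (simp add: f0 pt_def grid_def)

subsection \<open>Second differences and shape parameters\<close>

lemma d_0_error: "\<bar>d 0 j - h\<^sup>2 * f2 (pt 0 j)\<bar> \<le> 2 * M * h ^ 3"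
proof -
  have p: "pt 0 (j + 1) = pt 0 j + h" "pt 0 (j - 1) = pt 0 j + - h"
    using pt_neighbour[of 0 j 1] pt_neighbour[of 0 j "-1"] by simp_all
  have "d 0 j = G 0 (j - 1) - 2 * G 0 j + G 0 (j + 1)"
    using F_0 by (simp add: d_def cc_data_def second_diff_def)
  then have "d 0 j - h\<^sup>2 * f2 (pt 0 j)
     = (f (pt 0 j + h) - (f (pt 0 j) + f1 (pt 0 j) * h + f2 (pt 0 j) * h\<^sup>2 / 2))
     + (f (pt 0 j + - h) - (f (pt 0 j) + f1 (pt 0 j) * - h + f2 (pt 0 j) * (- h)\<^sup>2 / 2))"
    unfolding p by (simp add: field_simps)
  moreover note taylor[of "pt 0 j" h] taylor[of "pt 0 j" "-h"]
  moreover have "M * \<bar>- h\<bar> ^ 3 = M * h ^ 3" "M * \<bar>h\<bar> ^ 3 = M * h ^ 3" using h by simp_all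
  ultimately show ?thesis by linarith
qed

lemma d_Suc: "d (Suc k) l = 3 / 4 * d k (data_index l) + 1 / 4 * d k (data_index l + side l)"
  unfolding d_def by (rule cc_data_Suc)

lemma d_bound: "\<bar>d k j\<bar> \<le> 3 * M * h\<^sup>2"
proof (induction k arbitrary: j)
  case 0
  have "M * h ^ 3 \<le> M * h\<^sup>2" using h_power_mono[of 2 3] M1 by (intro mult_left_mono) auto
  moreover have "\<bar>h\<^sup>2 * f2 (pt 0 j)\<bar> \<le> h\<^sup>2 * M"
    unfolding abs_mult using f2_bound by (intro mult_mono) auto
  ultimately show ?case using d_0_error[of j] by (simp add: mult.commute)
next
  case (Suc k)
  show ?case
    using Suc[of "data_index j"] Suc[of "data_index j + side j"] unfolding d_Suc by linarith
qed

text \<open>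
  Corner cutting forms convex combinations, so it does not increase the error of the initial second
  differences; each level adds only the variation of \<open>f2\<close> over one mesh cell, and these variations form
  a geometric series.
\<close>

lemma d_error: "\<bar>d k j - h\<^sup>2 * f2 (pt k j)\<bar> \<le> 4 * M * h ^ 3"
proof -
  have "\<bar>d k j - h\<^sup>2 * f2 (pt k j)\<bar> \<le> M * h ^ 3 * (4 - 2 * (1 / 2 ^ k))"
  proof (induction k arbitrary: j)
    case 0
    show ?case using d_0_error[of j] by (simp add: ac_simps)
  next
    case (Suc k)
    define p :: real where "p = 1 / 2 ^ k"
    have p: "0 < p" by (simp add: p_def)
    let ?m = "data_index j" and ?n = "data_index j + side j"
    have step: "\<bar>h\<^sup>2 * f2 x - h\<^sup>2 * f2 y\<bar> \<le> M * h ^ 3 * (3 / 4 * p)" if "\<bar>x - y\<bar> \<le> 3 / 4 * (h * p)" for x y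
    proof -
      have "\<bar>h\<^sup>2 * f2 x - h\<^sup>2 * f2 y\<bar> = h\<^sup>2 * \<bar>f2 x - f2 y\<bar>"
        by (simp add: abs_mult flip: right_diff_distrib)
      also have "\<dots> \<le> h\<^sup>2 * (M * (3 / 4 * (h * p)))"
        using f2_lip[of x y] that M1 by (intro mult_left_mono order.trans[OF f2_lip]) auto
      finally show ?thesis by (simp add: eval_nat_numeral ac_simps)
    qed
    have "h * p > 0" using h p by simp
    then have "\<bar>h\<^sup>2 * f2 (pt k ?m) - h\<^sup>2 * f2 (pt (Suc k) j)\<bar> \<le> M * h ^ 3 * (3 / 4 * p)"
      "\<bar>h\<^sup>2 * f2 (pt k ?n) - h\<^sup>2 * f2 (pt (Suc k) j)\<bar> \<le> M * h ^ 3 * (3 / 4 * p)"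
      by (auto intro!: step simp only: pt_distances p_def[symmetric])
    moreover have "1 / 2 ^ Suc k = p / 2" by (simp add: p_def)
    moreover have "M * h ^ 3 * (3 / 4 * p) \<le> M * h ^ 3 * p" using M1 h p by (intro mult_left_mono) auto
    ultimately show ?case
      using Suc[of ?m] Suc[of ?n] unfolding d_Suc p_def[symmetric] abs_le_iff
      by (simp add: algebra_simps)
  qed
  also have "\<dots> \<le> M * h ^ 3 * 4" using M1 h by (intro mult_left_mono) auto
  finally show ?thesis by (simp add: ac_simps)
qed

lemma eps_abs: "\<bar>\<epsilon> k l\<bar> = h\<^sup>2"
  using eps by (simp add: nucc_eps_def h_def power_mult power_divide mult.commute flip: power_mult)

text \<open>
  This is the purpose of the sign rule for the regularization: the denominator cannot cancel, and it
  dominates both the datum and \<open>h\<^sup>2\<close>.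
\<close>

lemma denominator_abs: "\<bar>F k (data_index l) + \<epsilon> k l\<bar> = \<bar>F k (data_index l)\<bar> + h\<^sup>2"
proof -
  have "F k (data_index l) \<noteq> 0 \<longrightarrow> sgn (\<epsilon> k l) = sgn (F k (data_index l))"
    using eps unfolding nucc_eps_def by blast
  then show ?thesis unfolding eps_abs[of k l, symmetric]
    by (auto simp: sgn_if abs_if split: if_splits)
qed

lemma denominator_pos: "0 < \<bar>F k (data_index l) + \<epsilon> k l\<bar>"
  unfolding denominator_abs using h by (intro add_nonneg_pos) auto

lemma w_times_denominator: "w k l * (F k (data_index l) + \<epsilon> k l) = d k (data_index l) / 4 ^ k"
  using denominator_pos[of k l] by (simp add: w_def)

text \<open>
  The second differences are of the same order \<open>h\<^sup>2\<close> as the regularization, so that the bounds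
  on \<open>w\<close> and \<open>w F\<close> that follow are uniform in \<open>k0\<close> and do not require \<open>F\<close> to stay away from 0.
\<close>

lemma w_times_abs: "\<bar>w k l\<bar> * (\<bar>F k (data_index l)\<bar> + h\<^sup>2) \<le> 3 * M * h\<^sup>2 * (1 / 2 ^ k)\<^sup>2"
proof -
  have "\<bar>w k l\<bar> * (\<bar>F k (data_index l)\<bar> + h\<^sup>2) = \<bar>d k (data_index l)\<bar> / 4 ^ k"
    using arg_cong[OF w_times_denominator[of k l], of abs]
    unfolding abs_mult denominator_abs by simp
  also have "\<dots> \<le> 3 * M * h\<^sup>2 / 4 ^ k" by (intro divide_right_mono d_bound) auto
  also have "\<dots> = 3 * M * h\<^sup>2 * (1 / 2 ^ k)\<^sup>2"
    by (simp add: power_divide power2_eq_square flip: power_mult_distrib)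
  finally show ?thesis .
qed

lemma w_F_bound: "\<bar>w k l\<bar> * \<bar>F k (data_index l)\<bar> \<le> 3 * M * h\<^sup>2 * (1 / 2 ^ k)\<^sup>2"
proof -
  have "\<bar>w k l\<bar> * \<bar>F k (data_index l)\<bar> \<le> \<bar>w k l\<bar> * (\<bar>F k (data_index l)\<bar> + h\<^sup>2)"
    by (intro mult_left_mono) auto
  also note w_times_abs
  finally show ?thesis .
qed

lemma w_bound: "\<bar>w k l\<bar> \<le> 3 * M * (1 / 2 ^ k)\<^sup>2"
proof -
  have "\<bar>w k l\<bar> * h\<^sup>2 \<le> \<bar>w k l\<bar> * (\<bar>F k (data_index l)\<bar> + h\<^sup>2)"
    by (intro mult_left_mono) auto
  also note w_times_abs
  finally have "\<bar>w k l\<bar> * h\<^sup>2 \<le> (3 * M * (1 / 2 ^ k)\<^sup>2) * h\<^sup>2" by (simp add: ac_simps)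
  then show ?thesis using h by (subst (asm) mult_le_cancel_right) auto
qed

lemma shape_squared: "(nucc_shape \<epsilon> f0 k l / 2 ^ k)\<^sup>2 = complex_of_real (w k l)"
proof -
  have "((2::complex) ^ k)\<^sup>2 = 4 ^ k"
    by (simp add: power2_eq_square flip: power_mult_distrib)
  then show ?thesis
    by (simp add: nucc_shape_def shape_param_def power_divide w_def d_def)
qed

lemma weights_near_corner_cutting:
  "\<bar>near_weight k l - 3 / 4\<bar> \<le> 1 / 4" "\<bar>far_weight k l - 1 / 4\<bar> \<le> 1 / 4"
proof -
  let ?a = "nucc_level_mask \<epsilon> f0 k (l div 2)"
  have b: "\<bar>?a n - cc_mask n\<bar> \<le> 1 / 4" if "n \<in> {-2, -1, 0, 1}" for n
    using standing that unfolding nucc_standing_def abs_le_iff by (smt (verit, best))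
  have "?a (if even l then 0 else -1) = near_weight k l"
    "?a (if even l then -2 else 1) = far_weight k l"
    by (auto simp: nucc_level_mask_def nucc_mask_def near_weight_def far_weight_def nucc_shape_def)
  then show "\<bar>near_weight k l - 3 / 4\<bar> \<le> 1 / 4" "\<bar>far_weight k l - 1 / 4\<bar> \<le> 1 / 4"
    using b[of "if even l then 0 else -1"] b[of "if even l then -2 else 1"]
    by (auto simp: cc_mask_def split: if_splits)
qed

text \<open>
  The coefficients come from \<open>c (c\<^sup>2 - 1) / 6\<close>, which is \<open>- 7/128\<close> at \<open>c = 3/4\<close> and \<open>- 5/128\<close> at \<open>c = 1/4\<close>.
\<close>

lemma weight_expansion:
  "\<bar>near_weight k l - 3 / 4\<bar> \<le> 2 * \<bar>w k l\<bar>"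
  "\<bar>far_weight k l - 1 / 4\<bar> \<le> 2 * \<bar>w k l\<bar>"
  "\<bar>near_weight k l - 3 / 4 + 7 / 128 * w k l\<bar> \<le> (w k l)\<^sup>2"
  "\<bar>far_weight k l - 1 / 4 + 5 / 128 * w k l\<bar> \<le> (w k l)\<^sup>2"
  using sinh_ratio_second_order[OF shape_squared, of "3 / 4" k l]
    sinh_ratio_second_order[OF shape_squared, of "1 / 4" k l] weights_near_corner_cutting[of k l]
  unfolding near_weight_def[symmetric] far_weight_def[symmetric]
  by (simp_all add: power2_eq_square algebra_simps)

subsection \<open>First order estimate on the whole line\<close>

text \<open>
  Corner cutting reproduces \<open>f\<close> up to \<open>O(h / 2 ^ k)\<close>. The deviation of the near weight from \<open>3/4\<close> multiplies
  the datum in the denominator of \<open>w\<close>, so \<open>w F\<close> is small. The far weight multiplies the neighbouring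
  datum instead, which differs from the former by the variation of \<open>f\<close> and twice the error \<open>B\<close>;
  this is where the amplification comes from.
\<close>

lemma coarse_step:
  assumes B: "\<And>i. \<bar>F k i - G k i\<bar> \<le> B"
  shows "\<bar>F (Suc k) l - G (Suc k) l\<bar> \<le> (1 + 12 * M / 2 ^ k) * B + 19 * M\<^sup>2 * h / 2 ^ k"
proof -
  define p :: real where "p = 1 / 2 ^ k"
  have p: "0 < p" "p \<le> 1" by (simp_all add: p_def)
  let ?m = "data_index l" and ?n = "data_index l + side l"
  let ?w = "w k l" and ?r = "near_weight k l" and ?s = "far_weight k l"
  have B0: "B \<ge> 0" using B[of 0] by linarith
  have hp: "0 < h * p" "h * p \<le> h" using h p by (simp_all add: mult_left_le)
  have p2: "p\<^sup>2 \<le> p" using p by (simp add: power2_eq_square mult_left_le)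
  have h2p2: "h\<^sup>2 * p\<^sup>2 \<le> h * p"
    using h p2 h_power_mono[of 1 2] by (intro mult_mono) auto
  have G: "\<bar>G k ?m - G (Suc k) l\<bar> \<le> M * (h * p / 4)" "\<bar>G k ?n - G (Suc k) l\<bar> \<le> M * (3 / 4 * (h * p))"
    "\<bar>G k ?n - G k ?m\<bar> \<le> M * (h * p)"
    using f_lip[of "pt k ?m" "pt (Suc k) l"] f_lip[of "pt k ?n" "pt (Suc k) l"] f_lip[of "pt k ?n" "pt k ?m"]
    by (simp_all only: pt_distances p_def[symmetric])
  have w: "\<bar>?w\<bar> \<le> 3 * M * p"
    using w_bound[of k l] p2 M1 unfolding p_def[symmetric]
    by (elim order.trans) (intro mult_left_mono, auto)
  have wF: "\<bar>?w\<bar> * \<bar>F k ?m\<bar> \<le> 3 * M * (h * p)"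
  proof -
    have "3 * M * (h\<^sup>2 * p\<^sup>2) \<le> 3 * M * (h * p)" using h2p2 M1 by (intro mult_left_mono) auto
    then show ?thesis using w_F_bound[of k l] unfolding p_def[symmetric] by (simp add: ac_simps)
  qed
  have t1: "\<bar>(?r - 3 / 4) * F k ?m\<bar> \<le> 6 * (M * (h * p))"
  proof -
    have "\<bar>(?r - 3 / 4) * F k ?m\<bar> \<le> (2 * \<bar>?w\<bar>) * \<bar>F k ?m\<bar>"
      unfolding abs_mult by (intro mult_right_mono weight_expansion) auto
    then show ?thesis using wF by simp
  qed
  have t2: "\<bar>(?s - 1 / 4) * F k ?n\<bar> \<le> 6 * (M * (h * p)) + 12 * M * p * B + 6 * (M\<^sup>2 * (h * p))"
  proof -
    have "\<bar>F k ?n\<bar> \<le> \<bar>F k ?m\<bar> + (2 * B + M * h)"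
    proof -
      have "M * (h * p) \<le> M * h" using hp M1 by (intro mult_left_mono) auto
      then show ?thesis using B[of ?m] B[of ?n] G(3) by linarith
    qed
    then have "\<bar>(?s - 1 / 4) * F k ?n\<bar> \<le> (2 * \<bar>?w\<bar>) * (\<bar>F k ?m\<bar> + (2 * B + M * h))"
      unfolding abs_mult by (intro mult_mono weight_expansion) auto
    also have "\<dots> = 2 * (\<bar>?w\<bar> * \<bar>F k ?m\<bar>) + 2 * (\<bar>?w\<bar> * (2 * B + M * h))" by (simp add: algebra_simps)
    also have "\<bar>?w\<bar> * (2 * B + M * h) \<le> (3 * M * p) * (2 * B + M * h)"
      using w B0 M1 h by (intro mult_right_mono) auto
    finally show ?thesis using wF by (simp add: algebra_simps power2_eq_square)
  qed
  have split: "F (Suc k) l - G (Suc k) l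
      = 3 / 4 * (F k ?m - G k ?m) + 1 / 4 * (F k ?n - G k ?n)
      + 3 / 4 * (G k ?m - G (Suc k) l) + 1 / 4 * (G k ?n - G (Suc k) l)
      + (?r - 3 / 4) * F k ?m + (?s - 1 / 4) * F k ?n"
    unfolding F_Suc by (simp add: algebra_simps)
  have "\<bar>F (Suc k) l - G (Suc k) l\<bar>
      \<le> B + 12 * M * p * B + 13 * (M * (h * p)) + 6 * (M\<^sup>2 * (h * p))"
  proof -
    have tri: "\<bar>3 / 4 * a + 1 / 4 * b + 3 / 4 * c + 1 / 4 * d + u + v\<bar> \<le> B + y + 13 * x + z"
      if "\<bar>a\<bar> \<le> B" "\<bar>b\<bar> \<le> B" "\<bar>c\<bar> \<le> 1 / 4 * x" "\<bar>d\<bar> \<le> 3 / 4 * x" "\<bar>u\<bar> \<le> 6 * x"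
        "\<bar>v\<bar> \<le> 6 * x + y + z" "0 \<le> x" for a b c d u v x y z :: real
      using that by linarith
    have "0 \<le> M * (h * p)" using M1 hp by simp
    note bound = tri[OF B B _ _ t1 t2 this]
    show ?thesis
      unfolding split by (rule bound) (use G(1,2) in \<open>simp_all add: mult.left_commute\<close>)
  qed
  moreover have "M * (h * p) \<le> M\<^sup>2 * (h * p)"
    using M1 hp by (intro mult_right_mono) (auto simp: power2_eq_square)
  ultimately have "\<bar>F (Suc k) l - G (Suc k) l\<bar> \<le> B + 12 * M * p * B + 19 * (M\<^sup>2 * (h * p))"
    by linarith
  also have "\<dots> = (1 + 12 * M / 2 ^ k) * B + 19 * M\<^sup>2 * h / 2 ^ k"
    unfolding p_def by (simp add: algebra_simps)
  finally show ?thesis .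
qed

lemma coarse_const_pos: "0 < coarse_const M"
  using M1 by (simp add: coarse_const_def)

lemma coarse_error: "\<bar>F k j - G k j\<bar> \<le> coarse_const M * h"
proof -
  have "\<bar>F k j - G k j\<bar> \<le> (19 * M\<^sup>2 * h) / (12 * M) * exp (2 * (12 * M))"
    by (rule discrete_gronwall[where e = "\<lambda>k j. \<bar>F k j - G k j\<bar>" and W = "\<lambda>_. UNIV"])
      (use M1 h coarse_step in \<open>auto simp: F_0 simp del: nucc.simps\<close>)
  also have "(19 * M\<^sup>2 * h) / (12 * M) = (19 / 12) * (M * h)"
    using M1 by (simp add: power2_eq_square field_simps)
  also have "\<dots> * exp (2 * (12 * M)) \<le> (2 * (M * h)) * exp (2 * (12 * M))"
    using M1 h by (intro mult_right_mono) auto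
  finally show ?thesis by (simp add: coarse_const_def ac_simps)
qed

subsection \<open>Third order estimate away from zeros\<close>

lemma insertion_consistency:
  "\<bar>3 / 4 * f x + 1 / 4 * f (x + s) - f (x + s / 4) - 3 / 32 * (s\<^sup>2 * f2 x)\<bar> \<le> M * \<bar>s\<bar> ^ 3"
proof -
  have "3 / 4 * f x + 1 / 4 * f (x + s) - f (x + s / 4) - 3 / 32 * (s\<^sup>2 * f2 x)
      = 1 / 4 * (f (x + s) - (f x + f1 x * s + f2 x * s\<^sup>2 / 2))
        - (f (x + s / 4) - (f x + f1 x * (s / 4) + f2 x * (s / 4)\<^sup>2 / 2))"
    by (simp add: power2_eq_square field_simps)
  then have eq: "3 / 4 * f x + 1 / 4 * f (x + s) - f (x + s / 4) - 3 / 32 * (s\<^sup>2 * f2 x) = 1 / 4 * a - b"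
    if "a = f (x + s) - (f x + f1 x * s + f2 x * s\<^sup>2 / 2)"
      "b = f (x + s / 4) - (f x + f1 x * (s / 4) + f2 x * (s / 4)\<^sup>2 / 2)" for a b
    using that by simp
  have "\<bar>1 / 4 * a - b\<bar> \<le> e" if "\<bar>a\<bar> \<le> e" "\<bar>b\<bar> \<le> 1 / 64 * e" for a b e :: real
    using that by linarith
  moreover have "M * \<bar>s / 4\<bar> ^ 3 = 1 / 64 * (M * \<bar>s\<bar> ^ 3)" by (simp add: power_divide)
  ultimately show ?thesis
    unfolding eq[OF refl refl] using taylor[of x s] taylor[of x "s / 4"] by metis
qed

lemma defect_const_pos: "\<tau> > 0 \<Longrightarrow> defect_const M \<tau> > 0"
  unfolding defect_const_def Let_def using M1 coarse_const_pos by (intro add_pos_nonneg) auto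

text \<open>
  The defect splits into four parts: the consistency error of the corrected linear interpolation
  (\<open>e1\<close>); the difference between \<open>w f\<close> and the scaled second derivative (\<open>e2\<close>); the effect of
  using \<open>f\<close> at one point instead of two in the correction (\<open>e3\<close>); and the second order remainders of
  both weights (\<open>e5\<close>). In \<open>e2\<close> the error \<open>F - G\<close> enters multiplied by \<open>w = O(h\<^sup>2 / 4 ^ k)\<close>,
  so that the first order estimate for it is good enough.
\<close>

lemma fine_step:
  assumes "\<tau> > 0" and big: "\<bar>F k (data_index l)\<bar> \<ge> \<tau> / 2"
    and Bm: "\<bar>F k (data_index l) - G k (data_index l)\<bar> \<le> B"
    and Bn: "\<bar>F k (data_index l + side l) - G k (data_index l + side l)\<bar> \<le> B"
  shows "\<bar>F (Suc k) l - G (Suc k) l\<bar> \<le> (1 + 12 * M / 2 ^ k) * B + defect_const M \<tau> * h ^ 3 / 2 ^ k"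
proof -
  define p :: real where "p = 1 / 2 ^ k"
  have p: "0 < p" "p \<le> 1" by (simp_all add: p_def)
  define W where "W = 6 * M / \<tau>"
  have W: "W > 0" using M1 \<open>\<tau> > 0\<close> by (simp add: W_def)
  have K: "defect_const M \<tau> = 5 * M + W * (coarse_const M + 1 + M) + 2 * M * W\<^sup>2"
    by (simp only: defect_const_def Let_def W_def)
  let ?m = "data_index l" and ?n = "data_index l + side l"
  let ?w = "w k l" and ?r = "near_weight k l" and ?s = "far_weight k l"
  let ?x = "pt k ?m" and ?\<sigma> = "real_of_int (side l) * (h * p)"
  have B0: "B \<ge> 0" using Bm by linarith
  have hp: "0 < h * p" using h p by simp
  have pp: "p ^ Suc i \<le> p" for i using p power_decreasing[of 1 "Suc i" p] by simp
  have pn: "pt k ?n = ?x + ?\<sigma>" and pS: "pt (Suc k) l = ?x + ?\<sigma> / 4"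
    by (simp_all add: pt_neighbour pt_Suc p_def)
  have \<sigma>: "\<bar>?\<sigma>\<bar> = h * p" "?\<sigma>\<^sup>2 = h\<^sup>2 * p\<^sup>2"
    using side_cases[of l] hp by (auto simp: power_mult_distrib)
  have w: "\<bar>?w\<bar> \<le> W * (h\<^sup>2 * p\<^sup>2)"
  proof -
    have "\<bar>?w\<bar> * (\<tau> / 2) \<le> \<bar>?w\<bar> * \<bar>F k ?m\<bar>" using big by (intro mult_left_mono) auto
    also note w_F_bound
    finally show ?thesis using \<open>\<tau> > 0\<close> unfolding W_def p_def by (simp add: field_simps)
  qed
  have w1: "4 * \<bar>?w\<bar> \<le> 12 * M * p"
  proof -
    have "3 * M * p\<^sup>2 \<le> 3 * M * p" using pp[of 1] M1 by (intro mult_left_mono) (auto simp: power2_eq_square)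
    then show ?thesis using w_bound[of k l] unfolding p_def[symmetric] by linarith
  qed
  have e0: "\<bar>?r * (F k ?m - G k ?m) + ?s * (F k ?n - G k ?n)\<bar> \<le> (1 + 12 * M * p) * B"
  proof -
    have "\<bar>?r * (F k ?m - G k ?m) + ?s * (F k ?n - G k ?n)\<bar> \<le> \<bar>?r\<bar> * B + \<bar>?s\<bar> * B"
      using Bm Bn by (intro order.trans[OF abs_triangle_ineq] add_mono) (auto simp: abs_mult intro!: mult_left_mono)
    also have "\<dots> = (\<bar>?r\<bar> + \<bar>?s\<bar>) * B" by (simp add: algebra_simps)
    also have "\<dots> \<le> (1 + 12 * M * p) * B"
      using weight_expansion(1,2)[of k l] w1 B0 by (intro mult_right_mono) auto
    finally show ?thesis .
  qed
  have e1: "\<bar>3 / 4 * G k ?m + 1 / 4 * G k ?n - G (Suc k) l - 3 / 32 * ((h\<^sup>2 * p\<^sup>2) * f2 ?x)\<bar> \<le> M * (h ^ 3 * p)"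
  proof -
    have "M * (h * p) ^ 3 \<le> M * (h ^ 3 * p)"
      unfolding power_mult_distrib using pp[of 2] M1 h by (intro mult_left_mono) (auto simp: eval_nat_numeral)
    then show ?thesis using insertion_consistency[of ?x ?\<sigma>] unfolding pn pS \<sigma> by simp
  qed
  have hh: "h ^ 4 \<le> h ^ 3" using h_power_mono[of 3 4] by simp
  have e2: "\<bar>(h\<^sup>2 * p\<^sup>2) * f2 ?x - ?w * G k ?m\<bar> \<le> 4 * (M * (h ^ 3 * p)) + W * (coarse_const M + 1) * (h ^ 3 * p)"
  proof -
    have p4: "x / 4 ^ k = x * p\<^sup>2" for x :: real
      by (simp add: p_def power_divide power2_eq_square flip: power_mult_distrib)
    have "(h\<^sup>2 * p\<^sup>2) * f2 ?x - ?w * G k ?m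
        = - p\<^sup>2 * (d k ?m - h\<^sup>2 * f2 ?x) + ?w * (F k ?m - G k ?m + \<epsilon> k l)"
      using w_times_denominator[of k l] unfolding p4 by (simp add: algebra_simps)
    moreover have "\<bar>- p\<^sup>2 * (d k ?m - h\<^sup>2 * f2 ?x)\<bar> \<le> p * (4 * M * h ^ 3)"
      unfolding abs_mult using pp[of 1] p d_error by (intro mult_mono) (auto simp: power2_eq_square)
    moreover have "\<bar>?w * (F k ?m - G k ?m + \<epsilon> k l)\<bar> \<le> (W * (h\<^sup>2 * p)) * ((coarse_const M + 1) * h)"
    proof -
      have "\<bar>F k ?m - G k ?m + \<epsilon> k l\<bar> \<le> (coarse_const M + 1) * h"
        using coarse_error[of k ?m] eps_abs[of k l] h_power_mono[of 1 2] unfolding distrib_right by simp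
      moreover have "\<bar>?w\<bar> \<le> W * (h\<^sup>2 * p)"
        using w pp[of 1] W h by (elim order.trans) (intro mult_left_mono, auto simp: power2_eq_square)
      ultimately show ?thesis unfolding abs_mult by (intro mult_mono) (use W h p in auto)
    qed
    ultimately show ?thesis unfolding abs_le_iff by (simp add: algebra_simps eval_nat_numeral)
  qed
  have e3: "\<bar>?w * (G k ?n - G k ?m)\<bar> \<le> W * M * (h ^ 3 * p)"
  proof -
    have "\<bar>G k ?n - G k ?m\<bar> \<le> M * (h * p)"
      using f_lip[of "pt k ?n" ?x] \<sigma>(1) unfolding pn by simp
    then have "\<bar>?w * (G k ?n - G k ?m)\<bar> \<le> (W * (h\<^sup>2 * p\<^sup>2)) * (M * (h * p))"
      unfolding abs_mult using w by (intro mult_mono) auto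
    also have "\<dots> = W * M * (h ^ 3 * p ^ 3)" by (simp add: eval_nat_numeral)
    also have "\<dots> \<le> W * M * (h ^ 3 * p)"
      using pp[of 2] W M1 h by (intro mult_left_mono) (auto simp: eval_nat_numeral)
    finally show ?thesis .
  qed
  have w2: "?w\<^sup>2 \<le> W\<^sup>2 * (h ^ 3 * p)"
  proof -
    have "?w\<^sup>2 = \<bar>?w\<bar>\<^sup>2" by simp
    also have "\<dots> \<le> (W * (h\<^sup>2 * p\<^sup>2))\<^sup>2" using w by (intro power_mono) auto
    also have "\<dots> = W\<^sup>2 * (h ^ 4 * p ^ 4)" by (simp add: eval_nat_numeral)
    also have "\<dots> \<le> W\<^sup>2 * (h ^ 3 * p)"
      using hh pp[of 3] p h by (intro mult_left_mono mult_mono) (auto simp: eval_nat_numeral)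
    finally show ?thesis .
  qed
  have e4: "\<bar>u * g\<bar> \<le> M * W\<^sup>2 * (h ^ 3 * p)" if "\<bar>u\<bar> \<le> ?w\<^sup>2" "\<bar>g\<bar> \<le> M" for u g
  proof -
    have "\<bar>u * g\<bar> \<le> (W\<^sup>2 * (h ^ 3 * p)) * M"
      unfolding abs_mult using that w2 h p by (intro mult_mono) auto
    then show ?thesis by (simp add: ac_simps)
  qed
  have e5: "\<bar>(?r - 3 / 4 + 7 / 128 * ?w) * G k ?m\<bar> \<le> M * W\<^sup>2 * (h ^ 3 * p)"
    "\<bar>(?s - 1 / 4 + 5 / 128 * ?w) * G k ?n\<bar> \<le> M * W\<^sup>2 * (h ^ 3 * p)"
    by (intro e4 weight_expansion f_bound)+
  have split: "F (Suc k) l - G (Suc k) l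
      = (?r * (F k ?m - G k ?m) + ?s * (F k ?n - G k ?n))
      + (3 / 4 * G k ?m + 1 / 4 * G k ?n - G (Suc k) l - 3 / 32 * ((h\<^sup>2 * p\<^sup>2) * f2 ?x))
      + 3 / 32 * ((h\<^sup>2 * p\<^sup>2) * f2 ?x - ?w * G k ?m)
      - 5 / 128 * (?w * (G k ?n - G k ?m))
      + (?r - 3 / 4 + 7 / 128 * ?w) * G k ?m + (?s - 1 / 4 + 5 / 128 * ?w) * G k ?n"
    unfolding F_Suc by (simp add: field_simps)
  have "\<bar>F (Suc k) l - G (Suc k) l\<bar> \<le> (1 + 12 * M * p) * B
      + (M * (h ^ 3 * p) + (4 * (M * (h ^ 3 * p)) + W * (coarse_const M + 1) * (h ^ 3 * p)) + W * M * (h ^ 3 * p)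
         + 2 * (M * W\<^sup>2 * (h ^ 3 * p)))"
  proof -
    have nn: "0 \<le> M * (h ^ 3 * p)" "0 \<le> W * (coarse_const M + 1) * (h ^ 3 * p)" "0 \<le> W * M * (h ^ 3 * p)"
      using M1 W h p coarse_const_pos by simp_all
    have tri: "\<bar>a + b + 3 / 32 * c - 5 / 128 * d + r + s\<bar> \<le> A + (x + (4 * x + y) + z + 2 * v)"
      if "\<bar>a\<bar> \<le> A" "\<bar>b\<bar> \<le> x" "\<bar>c\<bar> \<le> 4 * x + y" "\<bar>d\<bar> \<le> z" "\<bar>r\<bar> \<le> v" "\<bar>s\<bar> \<le> v"
        "0 \<le> x" "0 \<le> y" "0 \<le> z" for a b c d r s A x y z v :: real
      using that by linarith
    show ?thesis unfolding split by (rule tri[OF e0 e1 e2 e3 e5 nn])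
  qed
  also have "\<dots> = (1 + 12 * M / 2 ^ k) * B + defect_const M \<tau> * h ^ 3 / 2 ^ k"
    unfolding K p_def by (simp add: algebra_simps add_divide_distrib)
  finally show ?thesis .
qed

text \<open>
  The window around \<open>tbar\<close> shrinks by \<open>h / 2 ^ k\<close> from level \<open>k\<close> to level \<open>k + 1\<close>, more than the distance
  \<open>3/4 * h / 2 ^ k\<close> of a new point to the farther point that it is computed from. Its radius never exceeds
  \<open>3 h\<close>, so that the smallness of \<open>h\<close> makes \<open>\<bar>F\<bar> \<ge> \<tau> / 2\<close> there.
\<close>

lemma fine_error:
  assumes "\<tau> > 0" "\<bar>f tbar\<bar> \<ge> \<tau>" and small: "(3 * M + coarse_const M) * h \<le> \<tau> / 2"
    and j: "\<bar>pt k j - tbar\<bar> \<le> (1 + 2 / 2 ^ k) * h"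
  shows "\<bar>F k j - G k j\<bar> \<le> defect_const M \<tau> * h ^ 3 / (12 * M) * exp (2 * (12 * M))"
proof -
  define W where "W k = {j. \<bar>pt k j - tbar\<bar> \<le> (1 + 2 / 2 ^ k) * h}" for k :: nat
  show ?thesis
  proof (rule discrete_gronwall[where e = "\<lambda>k j. \<bar>F k j - G k j\<bar>" and W = W])
    fix k l B
    assume B: "\<And>i. i \<in> W k \<Longrightarrow> \<bar>F k i - G k i\<bar> \<le> B" and l: "l \<in> W (Suc k)"
    define p :: real where "p = 1 / 2 ^ k"
    have p: "0 < p" "p \<le> 1" by (simp_all add: p_def)
    have hp: "0 < h * p" "h * p \<le> h" using h p by (simp_all add: mult_left_le)
    have "\<bar>pt (Suc k) l - tbar\<bar> \<le> h + h * p" using l by (simp add: W_def p_def algebra_simps)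
    then have pts: "\<bar>pt k (data_index l) - tbar\<bar> \<le> h + 2 * (h * p)"
      "\<bar>pt k (data_index l + side l) - tbar\<bar> \<le> h + 2 * (h * p)"
      using pt_distances(1,2)[of k l] hp unfolding p_def[symmetric] by linarith+
    then have near: "\<bar>pt k (data_index l) - tbar\<bar> \<le> 3 * h" using hp by linarith
    have in_W: "data_index l \<in> W k" "data_index l + side l \<in> W k"
      using pts by (simp_all add: W_def p_def algebra_simps)
    have "\<bar>F k (data_index l)\<bar> \<ge> \<tau> / 2"
    proof -
      have "\<bar>G k (data_index l) - f tbar\<bar> \<le> M * (3 * h)"
        using near M1 by (intro order.trans[OF f_lip] mult_left_mono) auto
      then show ?thesis
        using coarse_error[of k "data_index l"] assms(2) small by (simp add: algebra_simps)
    qed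
    then show "\<bar>F (Suc k) l - G (Suc k) l\<bar> \<le> (1 + (12 * M) / 2 ^ k) * B + (defect_const M \<tau> * h ^ 3) / 2 ^ k"
      by (rule fine_step[OF \<open>\<tau> > 0\<close> _ B[OF in_W(1)] B[OF in_W(2)]])
  qed (use j M1 h defect_const_pos[OF \<open>\<tau> > 0\<close>] in \<open>auto simp: W_def F_0 simp del: nucc.simps\<close>)
qed

text \<open>
  If \<open>h\<close> is not small, then \<open>q * h \<ge> 1\<close> with the \<open>q\<close> of the proof, and two such factors turn \<open>h\<close>
  into \<open>q\<^sup>2 h\<^sup>3\<close>.
\<close>

lemma cubic_error:
  assumes "\<tau> > 0" "\<bar>f tbar\<bar> \<ge> \<tau>" and j: "\<bar>pt k j - tbar\<bar> \<le> h"
  shows "\<bar>F k j - G k j\<bar> \<le> error_const M \<tau> * h ^ 3"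
proof -
  define cf where "cf = defect_const M \<tau> / (12 * M) * exp (2 * (12 * M))"
  define q where "q = 2 * (3 * M + coarse_const M) / \<tau>"
  have const: "error_const M \<tau> * h ^ 3 = cf * h ^ 3 + coarse_const M * q\<^sup>2 * h ^ 3"
    by (simp add: error_const_def cf_def q_def algebra_simps)
  have pos: "0 \<le> cf * h ^ 3" "0 \<le> coarse_const M * q\<^sup>2 * h ^ 3"
    using defect_const_pos[OF assms(1)] coarse_const_pos M1 h by (simp_all add: cf_def)
  show ?thesis
  proof (cases "(3 * M + coarse_const M) * h \<le> \<tau> / 2")
    case True
    have "h \<le> (1 + 2 / 2 ^ k) * h" using h by simp
    then have "\<bar>F k j - G k j\<bar> \<le> cf * h ^ 3"
      using fine_error[OF assms(1,2) True order.trans[OF j]] by (simp add: cf_def ac_simps)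
    then show ?thesis using pos const by linarith
  next
    case False
    then have "1 \<le> q * h" using assms(1) by (simp add: q_def field_simps)
    then have "1 \<le> (q * h)\<^sup>2" by (rule one_le_power)
    then have "coarse_const M * h * 1 \<le> coarse_const M * h * (q * h)\<^sup>2"
      using coarse_const_pos h by (intro mult_left_mono) auto
    then have "coarse_const M * h \<le> coarse_const M * q\<^sup>2 * h ^ 3"
      by (simp add: eval_nat_numeral ac_simps)
    then show ?thesis using coarse_error[of k j] pos const by linarith
  qed
qed

end

section \<open>Passage to the limit\<close>

text \<open>
  A point carries a datum of at most one level, so the value at \<open>tbar\<close> is approached along the points
  \<open>x k\<close> of level \<open>k\<close> nearest to it. Uniform convergence on a compact neighbourhood allows the
  index to move with \<open>k\<close>.
\<close>

lemma limit_function_error: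
  assumes lim: "is_limit_function k0 F g" and f: "continuous_on UNIV f"
    and E: "\<And>k j. \<bar>grid k j / 2 ^ k0 - tbar\<bar> \<le> 1 / 2 ^ k0 \<Longrightarrow> \<bar>F k j - f (grid k j / 2 ^ k0)\<bar> \<le> E"
  shows "\<bar>g tbar - f tbar\<bar> \<le> E"
proof -
  define T where "T = 2 ^ k0 * tbar"
  (* Data sit at (j - 1/2) / 2 ^ k, so the ceiling leaves an offset of at most half a mesh size. *)
  define J where "J k = \<lceil>2 ^ k * T\<rceil>" for k :: nat
  define x where "x k = grid k (J k) / 2 ^ k0" for k
  have g: "continuous_on UNIV g" using lim by (simp add: is_limit_function_def)
  have J: "\<bar>real_of_int (J k) - 2 ^ k * T - 1 / 2\<bar> \<le> 1 / 2" for k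
    unfolding J_def by linarith
  have x: "\<bar>x k - tbar\<bar> \<le> 1 / 2 ^ k / 2 ^ k0" for k
  proof -
    have "x k - tbar = (real_of_int (J k) - 2 ^ k * T - 1 / 2) / (2 ^ k * 2 ^ k0)"
      by (simp add: x_def grid_def T_def field_simps)
    then show ?thesis using J[of k] by (simp add: abs_mult divide_right_mono)
  qed
  have "(\<lambda>k. 1 / 2 ^ k / 2 ^ k0 :: real) \<longlonglongrightarrow> 0"
    using tendsto_divide[OF LIMSEQ_power_zero[of "1 / 2 :: real"] tendsto_const[of "2 ^ k0"]]
    by (simp add: power_divide)
  then have xlim: "x \<longlonglongrightarrow> tbar"
    using x by (subst LIM_zero_iff[symmetric]) (rule Lim_null_comparison[rotated], auto)
  have *: "(\<lambda>k. u (x k)) \<longlonglongrightarrow> u tbar" if "continuous_on UNIV u" for u :: "real \<Rightarrow> real"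
    using continuous_on_tendsto_compose[OF that xlim] by simp
  define S where "S k = (SUP j\<in>{j. real_of_int j \<in> (\<lambda>x. 2 ^ k * x) ` {T - 1..T + 1}}.
               ennreal \<bar>F k j - g (grid k j / 2 ^ k0)\<bar>)" for k
  have S: "S \<longlonglongrightarrow> 0" using lim unfolding is_limit_function_def S_def by blast
  have "ennreal \<bar>F k (J k) - g (x k)\<bar> \<le> S k" for k
    unfolding S_def x_def
  proof (rule SUP_upper, clarify)
    have "\<bar>real_of_int (J k) / 2 ^ k - T\<bar> \<le> 1 / 2 ^ k"
    proof -
      have "real_of_int (J k) / 2 ^ k - T = (real_of_int (J k) - 2 ^ k * T) / 2 ^ k" by (simp add: field_simps)
      moreover have "\<bar>real_of_int (J k) - 2 ^ k * T\<bar> \<le> 1" using J[of k] by linarith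
      ultimately show ?thesis by (simp add: divide_right_mono)
    qed
    also have "\<dots> \<le> 1" by simp
    finally have "real_of_int (J k) / 2 ^ k \<in> {T - 1..T + 1}" unfolding atLeastAtMost_iff by linarith
    then show "real_of_int (J k) \<in> (\<lambda>x. 2 ^ k * x) ` {T - 1..T + 1}"
      by (rule rev_image_eqI) simp
  qed
  then have "(\<lambda>k. ennreal \<bar>F k (J k) - g (x k)\<bar>) \<longlonglongrightarrow> 0"
    by (intro tendsto_sandwich[OF _ _ tendsto_const S]) auto
  then have "(\<lambda>k. \<bar>F k (J k) - g (x k)\<bar>) \<longlonglongrightarrow> 0"
    using tendsto_ennreal_iff[of "\<lambda>k. \<bar>F k (J k) - g (x k)\<bar>" sequentially 0] by simp
  then have "(\<lambda>k. F k (J k) - g (x k)) \<longlonglongrightarrow> 0" by (rule tendsto_rabs_zero_cancel)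
  from tendsto_diff[OF tendsto_add[OF this *[OF g]] *[OF f]]
  have "(\<lambda>k. F k (J k) - f (x k)) \<longlonglongrightarrow> g tbar - f tbar" by simp
  then have "(\<lambda>k. \<bar>F k (J k) - f (x k)\<bar>) \<longlonglongrightarrow> \<bar>g tbar - f tbar\<bar>" by (rule tendsto_rabs)
  moreover have "\<bar>F k (J k) - f (x k)\<bar> \<le> E" for k
  proof -
    have "\<bar>x k - tbar\<bar> \<le> 1 / 2 ^ k0"
      by (rule order.trans[OF x divide_right_mono]) simp_all
    then show ?thesis using E[of k "J k"] by (simp add: x_def)
  qed
  ultimately show ?thesis by (intro LIMSEQ_le_const2) auto
qed

theorem theorem5p5:
  fixes f :: "real \<Rightarrow> real" and \<tau> :: real
  assumes "f \<in> sobolev_inf 3" and "\<tau> > 0"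
  shows "\<exists>c>0. \<forall>(k0::nat) (\<epsilon> :: nat \<Rightarrow> int \<Rightarrow> real) (f0 :: int \<Rightarrow> real) (finf :: real \<Rightarrow> real).
           f0 = (\<lambda>n. f ((real_of_int n - 1 / 2) / 2 ^ k0)) \<longrightarrow>
           nucc_eps k0 \<epsilon> f0 \<longrightarrow>
           nucc_standing \<epsilon> f0 \<longrightarrow>
           is_limit_function k0 (nucc \<epsilon> f0) finf \<longrightarrow>
           (\<forall>(k::nat) (j::int) tbar.
              tbar = grid (k + 1) j / 2 ^ k0 \<longrightarrow>
              (\<forall>t. \<bar>t - tbar\<bar> \<le> 1 / 2 ^ (k0 + k) \<longrightarrow> \<bar>f t\<bar> \<ge> \<tau>) \<longrightarrow>
              \<bar>finf tbar - f tbar\<bar> \<le> c / 2 ^ (3 * k0))"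
proof (rule sobolev_inf_3_classical[OF assms(1)])
  fix f1 f2 :: "real \<Rightarrow> real" and M :: real
  assume M1: "M \<ge> 1"
    and sob: "\<And>x. \<bar>f x\<bar> \<le> M" "\<And>x. \<bar>f2 x\<bar> \<le> M"
      "\<And>x y. \<bar>f x - f y\<bar> \<le> M * \<bar>x - y\<bar>" "\<And>x y. \<bar>f2 x - f2 y\<bar> \<le> M * \<bar>x - y\<bar>"
      "\<And>x s. \<bar>f (x + s) - (f x + f1 x * s + f2 x * s\<^sup>2 / 2)\<bar> \<le> M * \<bar>s\<bar> ^ 3"
  have \<tau>: "\<tau> > 0" by fact
  have bound: "\<bar>finf tbar - f tbar\<bar> \<le> error_const M \<tau> / 2 ^ (3 * k0)"
    if f0: "f0 = (\<lambda>n. f ((real_of_int n - 1 / 2) / 2 ^ k0))"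
      and eps: "nucc_eps k0 \<epsilon> f0" and standing: "nucc_standing \<epsilon> f0"
      and lim: "is_limit_function k0 (nucc \<epsilon> f0) finf"
      and large: "\<bar>f tbar\<bar> \<ge> \<tau>" for k0 \<epsilon> f0 finf tbar
  proof -
    interpret nucc_on_samples f f1 f2 M k0 \<epsilon> f0
      by unfold_locales (fact M1 sob f0 eps standing)+
    have "\<bar>finf tbar - f tbar\<bar> \<le> error_const M \<tau> * h ^ 3"
      by (rule limit_function_error[OF lim lipschitz_imp_continuous[OF sob(3)]])
        (rule cubic_error[OF \<tau> large, unfolded pt_def h_def[symmetric]], simp add: h_def)
    then show ?thesis by (simp add: h_def power_divide mult.commute flip: power_mult)
  qed
  have "error_const M \<tau> > 0"
    unfolding error_const_def defect_const_def coarse_const_def Let_def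
    using M1 \<tau> by (intro add_pos_nonneg mult_pos_pos divide_pos_pos) auto
  moreover have "\<bar>f tbar\<bar> \<ge> \<tau>" if "\<forall>t. \<bar>t - tbar\<bar> \<le> 1 / 2 ^ (k0 + k) \<longrightarrow> \<bar>f t\<bar> \<ge> \<tau>"
    for tbar :: real and k0 k :: nat
    using that by simp
  ultimately show ?thesis using bound by (intro exI[of _ "error_const M \<tau>"]) blast
qed

end
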